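(* Let $B=\lambda\mathbf{I}$ with $\lambda>0$ and let $f:\mathbb{R}^d\to\mathbb{R}$ be continuously differentiable with Lipschitz continuous gradient with constant $L_1>0$, i.e. $\|\nabla f(z_1)-\nabla f(z_2)\|_*\le L_1\|z_1-z_2\|$ for all $z_1,z_2\in\mathbb{R}^d$. Let $\mathcal{Z}=\mathcal{X}\times\mathcal{Y}\subset\mathbb{R}^n\times\mathbb{R}^m$ be nonempty, compact and convex with diameter $D_z=\sup\{\|z_1-z_2\|:z_1,z_2\in\mathcal{Z}\}$. Let $\mu>0$ and let $\sigma\ge 0$ satisfy $E_u[\|G_\mu(z;u)-F_\mu(z)\|_*^2]\le\sigma^2$ for all $z\in\mathbb{R}^d$. Suppose that for some $\rho\in(0,\frac{1}{24L_1})$ there is $z^*\in\mathcal{Z}$ satisfying the proximal weak Minty variational inequality: for all $z,\bar z\in\mathcal{Z}$ and all $a'>0$, $$\langle P_{\mathcal{Z}}(z,a',F(\bar z)),\bar z-z^*\rangle+\frac{\rho}{2}\|P_{\mathcal{Z}}(z,a',F(\bar z))\|_*^2\ge 0.$$ Let $\{z_k\},\{\hat z_k\}$ be generated by the (projected) zeroth-order extragradient algorithm ZO-EG with $h_{1,k}=h_{2,k}=h$, where $h\in\left(\sqrt{\frac{6\rho}{L_1\lambda^2}},\frac{1}{2L_1\lambda}\right]$. Let $p_k=P_{\mathcal{Z}}(z_k,h,F(z_k))$, $r_0=|z_0-z^*|$, $$a=\frac{4\rho\lambda L_1^2(d+3)^3}{\lambda^2L_1h^2-6\rho},\qquad b=\frac{4\lambda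 L_1D_z(d+3)^{3/2}}{\lambda^2L_1h^2-6\rho},$$ and let $\epsilon>0$. If $$\mu\le\min\left\{\frac{-b+\sqrt{b^2+a\epsilon^2}}{2a},\frac{\epsilon}{\sqrt2\,\lambda L_1(d+3)^{3/2}}\right\}\quad\text{and}\quad N\ge\left\lceil\left(\frac{16\lambda^2L_1r_0^2}{\lambda^2L_1h^2-6\rho}\right)\epsilon^{-2}-1\right\rceil,$$ then $$\frac{1}{N+1}\sum_{k=0}^{N}E_{\mathcal{U}_k}[|p_k|^2]\le\epsilon^2+\left(\frac{4(36\rho+\frac{4}{L_1})}{\lambda^2L_1h^2-6\rho}+4\right)\lambda\sigma^2+\frac{8D_z\lambda\sigma}{\lambda^2L_1h^2-6\rho}.$$
   Context: $n,m\in\mathbb{N}$, $d=n+m$, points $z=(x,y)\in\mathbb{R}^n\times\mathbb{R}^m=\mathbb{R}^d$. $B=\lambda\mathbf{I}$ with $\lambda>0$. $\langle\cdot,\cdot\rangle$ is the Euclidean inner product, $|z|=\langle z,z\rangle^{1/2}$, $\|z\|=\langle z,Bz\rangle^{1/2}=\sqrt{\lambda}|z|$, $\|z\|_*=\langle z,B^{-1}z\rangle^{1/2}=|z|/\sqrt{\lambda}$. $F(z)=(\nabla_x f(z),-\nabla_y f(z))$. For $\mu>0$ the Gaussian smoothing of $f$ is $f_\mu(z)=E_u[f(z+\mu u)]$ with $u\sim\mathcal{N}(0,B^{-1})$, and $F_\mu(z)=(\nabla_x f_\mu(z),-\nabla_y f_\mu(z))$. For $u=(u_1,u_2)\in\mathbb{R}^n\times\mathbb{R}^m$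 the random oracle is $G_\mu(z;u)=\frac{f(z+\mu u)-f(z)}{\mu}\,(\lambda u_1,-\lambda u_2)$. $\mathrm{Proj}_{\mathcal{Z}}(w)=\arg\min_{z\in\mathcal{Z}}\|z-w\|^2$, and $P_{\mathcal{Z}}(z,h,g)=\frac1h\left[z-\mathrm{Proj}_{\mathcal{Z}}(z-hg)\right]$ for $h>0$, $g\in\mathbb{R}^d$. ZO-EG (projected): given $z_0\in\mathcal{Z}$, for $k=0,1,\dots,N$: sample $\hat u_k\sim\mathcal{N}(0,B^{-1})$ and set $\hat z_k=\mathrm{Proj}_{\mathcal{Z}}(z_k-h_{1,k}G_\mu(z_k;\hat u_k))$; sample $u_k\sim\mathcal{N}(0,B^{-1})$ and set $z_{k+1}=\mathrm{Proj}_{\mathcal{Z}}(z_k-h_{2,k}G_\mu(\hat z_k;u_k))$. All sampled vectors are independent. $\mathcal{U}_k=[(u_0,\hat u_0),\dots,(u_k,\hat u_k)]$ and $E_{\mathcal{U}_k}$ is expectation over $\mathcal{U}_k$. *)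

theory Defs
  imports "HOL-Probability.Probability"
begin

text \<open>
  Throughout, \<open>lam\<close> is the scalar of the matrix \<open>B = lam I\<close>; \<open>normB\<close> and \<open>dnormB\<close> are the norms
  induced by \<open>B\<close> and by its inverse, while \<open>norm\<close> is the Euclidean norm.
\<close>

definition normB :: "real \<Rightarrow> 'a::real_inner \<Rightarrow> real" where
  "normB lam z = sqrt (z \<bullet> (lam *\<^sub>R z))"

definition dnormB :: "real \<Rightarrow> 'a::real_inner \<Rightarrow> real" where
  "dnormB lam z = sqrt (z \<bullet> (inverse lam *\<^sub>R z))"

text \<open>
  \<open>grad g z\<close> is unspecified when \<open>g\<close> is not differentiable at \<open>z\<close>; if the derivative exists,
  the description picks the unique gradient.
\<close>

definition grad :: "('a::real_inner \<Rightarrow> real) \<Rightarrow> 'a \<Rightarrow> 'a" where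
  "grad g z = (THE D. GDERIV g z :> D)"

definition saddle_op ::
    "('a::real_inner \<times> 'b::real_inner \<Rightarrow> real) \<Rightarrow> 'a \<times> 'b \<Rightarrow> 'a \<times> 'b" where
  "saddle_op f z =
     (grad (\<lambda>x. f (x, snd z)) (fst z), - grad (\<lambda>y. f (fst z, y)) (snd z))"

text \<open>
  The normal distribution with mean 0 and covariance \<open>I / lam\<close>: the coordinates are independent
  with standard deviation \<open>1 / sqrt lam\<close>.
\<close>

definition gaussian :: "real \<Rightarrow> 'a::euclidean_space measure" where
  "gaussian lam =
     density lborel (\<lambda>u. ennreal (\<Prod>b\<in>Basis. normal_density 0 (1 / sqrt lam) (u \<bullet> b)))"

definition smoothing :: "real \<Rightarrow> real \<Rightarrow> ('a::euclidean_space \<Rightarrow> real) \<Rightarrow> 'a \<Rightarrow> real" where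
  "smoothing lam \<mu> f z = (\<integral>u. f (z + \<mu> *\<^sub>R u) \<partial>(gaussian lam))"

definition zo_oracle ::
    "real \<Rightarrow> real \<Rightarrow> ('a::real_inner \<times> 'b::real_inner \<Rightarrow> real) \<Rightarrow> 'a \<times> 'b \<Rightarrow> 'a \<times> 'b \<Rightarrow> 'a \<times> 'b"
  where
  "zo_oracle lam \<mu> f z u =
     ((f (z + \<mu> *\<^sub>R u) - f z) / \<mu>) *\<^sub>R (lam *\<^sub>R fst u, - (lam *\<^sub>R snd u))"

definition proj :: "real \<Rightarrow> 'a::real_inner set \<Rightarrow> 'a \<Rightarrow> 'a" where
  "proj lam Z w = arg_min (\<lambda>z. (normB lam (z - w))\<^sup>2) (\<lambda>z. z \<in> Z)"

definition prox_grad :: "real \<Rightarrow> 'a::real_inner set \<Rightarrow> 'a \<Rightarrow> real \<Rightarrow> 'a \<Rightarrow> 'a" where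
  "prox_grad lam Z z h g = (1 / h) *\<^sub>R (z - proj lam Z (z - h *\<^sub>R g))"

definition prox_weak_MVI ::
    "real \<Rightarrow> ('a::real_inner \<Rightarrow> 'a) \<Rightarrow> 'a set \<Rightarrow> real \<Rightarrow> 'a \<Rightarrow> bool" where
  "prox_weak_MVI lam F Z \<rho> zs \<longleftrightarrow>
     (\<forall>z\<in>Z. \<forall>zb\<in>Z. \<forall>a>0.
        prox_grad lam Z z a (F zb) \<bullet> (zb - zs)
          + \<rho> / 2 * (dnormB lam (prox_grad lam Z z a (F zb)))\<^sup>2 \<ge> 0)"

text \<open>
  One sample path of the projected zeroth-order extragradient method: given the sampled vectors
  \<open>uh k\<close>, \<open>u k\<close> for \<open>k \<le> N\<close>, the sequences \<open>z\<close> and \<open>zh\<close> are the generated iterates.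
\<close>

definition zo_eg ::
    "real \<Rightarrow> real \<Rightarrow> ('a::real_inner \<times> 'b::real_inner \<Rightarrow> real) \<Rightarrow> ('a \<times> 'b) set
      \<Rightarrow> (nat \<Rightarrow> real) \<Rightarrow> (nat \<Rightarrow> real) \<Rightarrow> nat \<Rightarrow> 'a \<times> 'b
      \<Rightarrow> (nat \<Rightarrow> 'a \<times> 'b) \<Rightarrow> (nat \<Rightarrow> 'a \<times> 'b)
      \<Rightarrow> (nat \<Rightarrow> 'a \<times> 'b) \<Rightarrow> (nat \<Rightarrow> 'a \<times> 'b) \<Rightarrow> bool" where
  "zo_eg lam \<mu> f Z h1 h2 N z0 uh u zh z \<longleftrightarrow>
     z 0 = z0 \<and>
     (\<forall>k\<le>N.
        zh k = proj lam Z (z k - h1 k *\<^sub>R zo_oracle lam \<mu> f (z k) (uh k)) \<and>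
        z (Suc k) = proj lam Z (z k - h2 k *\<^sub>R zo_oracle lam \<mu> f (zh k) (u k)))"

end

theory Submission
  imports Defs
begin

text \<open>
  Let \<open>e\<close> and \<open>eh\<close> be the distances between the oracle outputs and the values of \<open>F\<close> at \<open>zh k\<close> and at
  \<open>z k\<close>. Expanding the squared distance to \<open>zs\<close> over one step, with the weak Minty inequality at
  \<open>zh k\<close> and nonexpansiveness of the projection, shows that it drops by a multiple of the squared
  residual, up to terms in \<open>e\<close> and \<open>eh\<close>. As each sample is independent of the point where the oracle is
  called, the moments of \<open>e\<close> and \<open>eh\<close> are bounded through \<open>\<sigma>\<close> and the smoothing bias at a fixed point,
  and telescoping gives the rate. If the trivial bound
  \<open>Dz / (sqrt lam * h)\<close> on the residuals exceeds \<open>\<epsilon>\<close>, the first condition on \<open>\<mu>\<close> makes all bias terms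
  small compared to \<open>\<epsilon>\<^sup>2\<close>; otherwise there is nothing to prove.
\<close>

section \<open>Projection and the extragradient step\<close>

text \<open>The projection is not linear, so an oracle error of mean zero need not have mean zero
  after projecting. Its contribution to the inner product is therefore estimated in absolute value
  against the diameter, which is why the first moment of \<open>e\<close> enters and where the term
  in \<open>Dz * \<sigma>\<close> comes from.

  The case split on \<open>Dz\<close> is forced by the shape of the condition on \<mu>. The
  coefficient \<open>a\<close> carries the factor \<rho>, which may be arbitrarily small, whereas
  the squared bias also enters with coefficients free of \<rho>; so \<open>a * \<mu>\<^sup>2\<close>
  cannot absorb it. The linear term \<open>b * \<mu>\<close> can, but it carries the factor
  \<open>Dz\<close>, which must then be bounded below.

  All estimates are Euclidean, with Lipschitz constant \<open>lam * L1\<close> for the gradient. The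
  descent coefficient is \<open>c = h\<^sup>2 - 6 * \<rho> / (lam\<^sup>2 * L1)\<close>, that is,
  the common denominator of the statement divided by \<open>lam\<^sup>2 * L1\<close>.\<close>

lemma normB_eq: "normB lam z = sqrt lam * norm z"
  by (simp add: normB_def norm_eq_sqrt_inner real_sqrt_mult)

lemma dnormB_eq: "dnormB lam z = norm z / sqrt lam"
  by (simp add: dnormB_def norm_eq_sqrt_inner real_sqrt_mult real_sqrt_inverse divide_inverse
      mult.commute)

text \<open>Scaling the norm by \<open>sqrt lam\<close> does not change minimizers.
  \<open>arg_min\<close> chooses some minimizer, which exists because \<open>Z\<close> is closed and
  nonempty, and convexity makes it unique.\<close>

lemma proj_eq_closest_point:
  fixes Z :: "'a::euclidean_space set"
  assumes "lam > 0" "convex Z" "closed Z" "Z \<noteq> {}"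
  shows "proj lam Z w = closest_point Z w"
proof -
  let ?c = "closest_point Z w"
  have le: "(normB lam (x - w))\<^sup>2 \<le> (normB lam (y - w))\<^sup>2 \<longleftrightarrow> dist w x \<le> dist w y" for x y :: 'a
    using assms(1) by (simp add: normB_eq power_mult_distrib dist_norm norm_minus_commute)
  have "is_arg_min (\<lambda>z. (normB lam (z - w))\<^sup>2) (\<lambda>z. z \<in> Z) ?c"
    using closest_point_exists[OF assms(3,4), of w] by (simp add: is_arg_min_linorder le)
  then have "is_arg_min (\<lambda>z. (normB lam (z - w))\<^sup>2) (\<lambda>z. z \<in> Z) (proj lam Z w)"
    unfolding proj_def arg_min_def by (rule someI)
  then show ?thesis
    by (intro closest_point_unique) (auto simp: is_arg_min_linorder le assms)
qed

context
  fixes lam :: real and Z :: "'a::euclidean_space set"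
  assumes lam: "lam > 0" and Z: "convex Z" "closed Z" "Z \<noteq> {}"
begin

lemma proj_in: "proj lam Z w \<in> Z"
  using closest_point_in_set[OF Z(2,3)] by (simp add: proj_eq_closest_point lam Z)

lemma proj_nonexpansive: "norm (proj lam Z v - proj lam Z w) \<le> norm (v - w)"
  using closest_point_lipschitz[OF Z] by (simp add: proj_eq_closest_point lam Z dist_norm)

lemma continuous_on_proj: "continuous_on UNIV (proj lam Z)"
proof -
  have "proj lam Z = closest_point Z" by (rule ext) (rule proj_eq_closest_point[OF lam Z])
  then show ?thesis using continuous_on_closest_point[OF Z] by simp
qed

text \<open>Dividing by \<open>h\<close> cancels the factor \<open>h\<close> in front of the
  direction, so the constant is 1 for every step size.\<close>

lemma prox_grad_nonexpansive:
  assumes h: "h > 0"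
  shows "norm (prox_grad lam Z z h g1 - prox_grad lam Z z h g2) \<le> norm (g1 - g2)"
proof -
  have "norm (prox_grad lam Z z h g1 - prox_grad lam Z z h g2)
      = norm (proj lam Z (z - h *\<^sub>R g2) - proj lam Z (z - h *\<^sub>R g1)) / h"
    using h by (simp add: prox_grad_def scaleR_diff_right[symmetric] divide_inverse_commute)
  also have "\<dots> \<le> norm ((z - h *\<^sub>R g2) - (z - h *\<^sub>R g1)) / h"
    using h by (intro divide_right_mono proj_nonexpansive) auto
  also have "\<dots> = norm (g1 - g2)"
    using h by (simp add: scaleR_diff_right[symmetric])
  finally show ?thesis .
qed

lemma proj_eq_prox_grad:
  "h > 0 \<Longrightarrow> proj lam Z (z - h *\<^sub>R g) = z - h *\<^sub>R prox_grad lam Z z h g"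
  by (simp add: prox_grad_def)

text \<open>Everything is measured by \<open>Q\<close>, the length of the half step divided by
  \<open>h\<close>. Polarization yields \<open>- h\<^sup>2 * Q\<^sup>2\<close>; the distance of
  \<open>P G\<close> from \<open>P Gh\<close> gives half of it back because
  \<open>L * h \<le> 1 / 2\<close>, and the Minty term gives back
  \<open>9 / 2 * h * \<rho> / lam * Q\<^sup>2\<close>. By the hypothesis on \<open>c\<close>, a
  descent of at least \<open>c / 2 * Q\<^sup>2\<close> remains. The squared residual is at most
  \<open>2 * Q\<^sup>2 + 2 * eh\<^sup>2\<close>, hence the factor \<open>c / 4\<close>.\<close>

lemma extragradient_step:
  fixes F :: "'a \<Rightarrow> 'a"
  assumes mvi: "prox_weak_MVI lam F Z \<rho> zs"
    and h: "h > 0" and zs: "zs \<in> Z" and z: "z \<in> Z"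
    and lip: "\<And>v w. norm (F v - F w) \<le> L * norm (v - w)" and Lh: "L * h \<le> 1 / 2" and L0: "L \<ge> 0"
    and rho: "\<rho> \<ge> 0"
    and diam: "\<And>v w. v \<in> Z \<Longrightarrow> w \<in> Z \<Longrightarrow> norm (v - w) \<le> D"
    and c: "c \<ge> 0" "c + 9 * h * \<rho> / lam \<le> h\<^sup>2"
    and zh: "zh = proj lam Z (z - h *\<^sub>R Gh)"
    and zn: "zn = proj lam Z (z - h *\<^sub>R G)"
    and e: "e = norm (G - F zh)" and eh: "eh = norm (Gh - F z)"
  shows "c / 4 * (norm (prox_grad lam Z z h (F z)))\<^sup>2
    \<le> (norm (z - zs))\<^sup>2 - (norm (zn - zs))\<^sup>2
      + 4 * h\<^sup>2 * (e\<^sup>2 + eh\<^sup>2) + 2 * h * D * e + (2 * h * \<rho> / lam + c / 2) * eh\<^sup>2"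
proof -
  define P where "P = prox_grad lam Z z h"
  define Q where "Q = norm (P Gh)"
  have e0: "e \<ge> 0" "eh \<ge> 0" "Q \<ge> 0" by (simp_all add: e eh Q_def)
  have zh': "zh = z - h *\<^sub>R P Gh" and zn': "zn = z - h *\<^sub>R P G"
    by (simp_all add: zh zn P_def proj_eq_prox_grad h)
  have zhZ: "zh \<in> Z" by (simp add: zh proj_in)
  have P_lip: "norm (P g1 - P g2) \<le> norm (g1 - g2)" for g1 g2
    unfolding P_def by (rule prox_grad_nonexpansive[OF h])
  have F_zh: "norm (F zh - F z) \<le> Q / 2"
  proof -
    have "norm (F zh - F z) \<le> L * norm (zh - z)" by (rule lip)
    also have "\<dots> = L * h * Q" using h by (simp add: zh' Q_def)
    also have "\<dots> \<le> 1 / 2 * Q" by (intro mult_right_mono Lh e0)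
    finally show ?thesis by simp
  qed
  have PG: "norm (P G - P Gh) \<le> e + eh + Q / 2"
  proof -
    have "norm (G - Gh) \<le> norm (G - F zh) + norm (F zh - F z) + norm (Gh - F z)"
      by norm
    then show ?thesis using P_lip[of G Gh] F_zh e eh by linarith
  qed
  have PF: "norm (P (F zh)) \<le> 3 / 2 * Q + eh"
  proof -
    have "norm (F zh - Gh) \<le> norm (F zh - F z) + norm (Gh - F z)" by norm
    moreover have "norm (P (F zh)) \<le> norm (P (F zh) - P Gh) + norm (P Gh)" by norm
    ultimately show ?thesis using P_lip[of "F zh" Gh] F_zh eh by (simp add: Q_def)
  qed
  have Pp: "norm (P (F z)) \<le> Q + eh"
  proof -
    have "norm (P (F z)) \<le> norm (P (F z) - P Gh) + norm (P Gh)" by norm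
    then show ?thesis using P_lip[of "F z" Gh] by (simp add: Q_def eh norm_minus_commute)
  qed
  have sq: "(norm (zn - zs))\<^sup>2 = (norm (z - zs))\<^sup>2 - 2 * h * (P G \<bullet> (z - zs)) + h\<^sup>2 * (norm (P G))\<^sup>2"
    unfolding zn' power2_norm_eq_inner by (simp add: inner_simps inner_commute power2_eq_square algebra_simps)
  \<comment> \<open>Three contributions: the shift from \<open>z\<close> to \<open>zh\<close>, the
    error of replacing \<open>G\<close> by \<open>F zh\<close>, and the quantity that the Minty
    inequality controls.\<close>
  have "P G \<bullet> (z - zs) = h * (P G \<bullet> P Gh) + (P G - P (F zh)) \<bullet> (zh - zs) + P (F zh) \<bullet> (zh - zs)"
    by (simp add: zh' inner_simps algebra_simps)
  \<comment> \<open>Polarization; after multiplication by \<open>2 * h\<close> its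
    \<open>(norm (P G))\<^sup>2\<close> cancels the last term of \<open>sq\<close>.\<close>
  moreover have "h * (P G \<bullet> P Gh) = h * (((norm (P G))\<^sup>2 + Q\<^sup>2 - (norm (P G - P Gh))\<^sup>2) / 2)"
    unfolding Q_def power2_norm_eq_inner by (simp add: inner_simps inner_commute algebra_simps)
  moreover have "(P G - P (F zh)) \<bullet> (zh - zs) \<ge> - (e * D)"
  proof -
    have "\<bar>(P G - P (F zh)) \<bullet> (zh - zs)\<bar> \<le> norm (P G - P (F zh)) * norm (zh - zs)"
      by (rule Cauchy_Schwarz_ineq2)
    also have "\<dots> \<le> e * D"
      using P_lip[of G "F zh"] diam[OF zhZ zs] e by (intro mult_mono) auto
    finally show ?thesis by simp
  qed
  \<comment> \<open>The inequality is used with base point \<open>z\<close>, step \<open>h\<close>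
    and operator point \<open>zh\<close>. The squared dual norm contributes the factor
    \<open>1 / lam\<close>.\<close>
  moreover have "P (F zh) \<bullet> (zh - zs) \<ge> - (\<rho> / (2 * lam) * (norm (P (F zh)))\<^sup>2)"
    using mvi z zhZ h lam unfolding prox_weak_MVI_def P_def dnormB_eq
    by (force simp: power_divide)
  ultimately have "2 * h * (P G \<bullet> (z - zs)) \<ge> 2 * h * (h * (((norm (P G))\<^sup>2 + Q\<^sup>2 - (norm (P G - P Gh))\<^sup>2) / 2)
      - e * D - \<rho> / (2 * lam) * (norm (P (F zh)))\<^sup>2)"
    using h by (intro mult_left_mono) linarith+
  then have main: "(norm (zn - zs))\<^sup>2 \<le> (norm (z - zs))\<^sup>2 - h\<^sup>2 * Q\<^sup>2 + h\<^sup>2 * (norm (P G - P Gh))\<^sup>2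
      + 2 * h * D * e + h * \<rho> / lam * (norm (P (F zh)))\<^sup>2"
    using h lam unfolding sq by (simp add: field_simps power2_eq_square)
  have young: "(x + y)\<^sup>2 \<le> 2 * x\<^sup>2 + 2 * y\<^sup>2" for x y :: real
    using sum_squares_bound[of x y] by (simp add: power2_sum)
  have "(norm (P G - P Gh))\<^sup>2 \<le> (e + eh + Q / 2)\<^sup>2"
    using PG by (intro power_mono) auto
  also have "\<dots> \<le> 4 * (e\<^sup>2 + eh\<^sup>2) + Q\<^sup>2 / 2"
    using young[of "e + eh" "Q / 2"] young[of e eh] by (simp add: power_divide)
  finally have 1: "h\<^sup>2 * (norm (P G - P Gh))\<^sup>2 \<le> h\<^sup>2 * (4 * (e\<^sup>2 + eh\<^sup>2) + Q\<^sup>2 / 2)"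
    by (intro mult_left_mono) auto
  have "(norm (P (F zh)))\<^sup>2 \<le> (3 / 2 * Q + eh)\<^sup>2"
    using PF by (intro power_mono) auto
  also have "\<dots> \<le> 9 / 2 * Q\<^sup>2 + 2 * eh\<^sup>2"
    using young[of "3 / 2 * Q" eh] by (simp add: power_mult_distrib power_divide)
  finally have 2: "h * \<rho> / lam * (norm (P (F zh)))\<^sup>2 \<le> h * \<rho> / lam * (9 / 2 * Q\<^sup>2 + 2 * eh\<^sup>2)"
    using h lam rho by (intro mult_left_mono) auto
  have "(norm (P (F z)))\<^sup>2 \<le> (Q + eh)\<^sup>2"
    using Pp by (intro power_mono) auto
  also have "\<dots> \<le> 2 * Q\<^sup>2 + 2 * eh\<^sup>2" by (rule young)
  finally have 3: "c / 4 * (norm (P (F z)))\<^sup>2 \<le> c / 4 * (2 * Q\<^sup>2 + 2 * eh\<^sup>2)"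
    using c by (intro mult_left_mono) auto
  have 4: "(c + 9 * h * \<rho> / lam) * Q\<^sup>2 \<le> h\<^sup>2 * Q\<^sup>2"
    using c by (intro mult_right_mono) auto
  \<comment> \<open>Collecting the \<open>Q\<^sup>2\<close> terms leaves exactly half the difference
    that fact \<open>4\<close> shows to be nonpositive.\<close>
  have eq: "c / 4 * (2 * Q\<^sup>2 + 2 * eh\<^sup>2) + h\<^sup>2 * (4 * (e\<^sup>2 + eh\<^sup>2) + Q\<^sup>2 / 2)
      + h * \<rho> / lam * (9 / 2 * Q\<^sup>2 + 2 * eh\<^sup>2) - h\<^sup>2 * Q\<^sup>2
     = 4 * h\<^sup>2 * (e\<^sup>2 + eh\<^sup>2) + (2 * h * \<rho> / lam + c / 2) * eh\<^sup>2
       + ((c + 9 * h * \<rho> / lam) * Q\<^sup>2 - h\<^sup>2 * Q\<^sup>2) / 2"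
    using lam by (simp add: field_simps)
  have "c / 4 * (2 * Q\<^sup>2 + 2 * eh\<^sup>2) + h\<^sup>2 * (4 * (e\<^sup>2 + eh\<^sup>2) + Q\<^sup>2 / 2)
      + h * \<rho> / lam * (9 / 2 * Q\<^sup>2 + 2 * eh\<^sup>2) - h\<^sup>2 * Q\<^sup>2
     \<le> 4 * h\<^sup>2 * (e\<^sup>2 + eh\<^sup>2) + (2 * h * \<rho> / lam + c / 2) * eh\<^sup>2"
    unfolding eq using 4 by simp
  with main 1 2 3 show ?thesis unfolding P_def by linarith
qed

end

section \<open>Gradients\<close>

lemma GDERIV_grad_eq:
  assumes "GDERIV g z :> D"
  shows "grad g z = D"
  unfolding grad_def
proof (rule the_equality)
  show "GDERIV g z :> D" by (fact assms)
next
  fix E assume "GDERIV g z :> E"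
  with assms have "(\<lambda>h. h \<bullet> E) = (\<lambda>h. h \<bullet> D)"
    unfolding gderiv_def by (metis has_derivative_unique)
  then show "E = D" by (metis vector_eq_ldot)
qed

lemma GDERIV_grad:
  fixes f :: "'a::euclidean_space \<Rightarrow> real"
  assumes "f differentiable (at w)"
  shows "GDERIV f w :> grad f w"
proof -
  obtain f' where f': "(f has_derivative f') (at w)"
    using assms by (auto simp: differentiable_def)
  then have "linear f'" by (rule has_derivative_linear)
  \<comment> \<open>The adjoint applied to 1 is the Riesz representative of the derivative, hence
    the gradient.\<close>
  then have "f' = (\<lambda>h. h \<bullet> adjoint f' 1)"
    using adjoint_works[of f' _ 1] by (force simp: inner_commute)
  then have "GDERIV f w :> adjoint f' 1" using f' by (simp add: gderiv_def)
  then show ?thesis by (simp add: GDERIV_grad_eq)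
qed

text \<open>Composing the total derivative with the embeddings of the two factors identifies the
  partial gradients with the components of \<open>D\<close>.\<close>

lemma saddle_op_eq:
  assumes "GDERIV f z :> D"
  shows "saddle_op f z = (fst D, - snd D)"
proof -
  obtain x y where z: "z = (x, y)" by (cases z)
  have f: "(f has_derivative (\<lambda>h. h \<bullet> D)) (at (x, y))"
    using assms by (simp add: gderiv_def z)
  have "((\<lambda>x. f (x, y)) has_derivative (\<lambda>h. (h, 0) \<bullet> D)) (at x)"
    by (rule has_derivative_compose[where g=f and f="\<lambda>x. (x, y)", OF _ f])
      (auto intro!: derivative_eq_intros)
  moreover have "((\<lambda>y. f (x, y)) has_derivative (\<lambda>h. (0, h) \<bullet> D)) (at y)"
    by (rule has_derivative_compose[where g=f and f="\<lambda>y. (x, y)", OF _ f])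
      (auto intro!: derivative_eq_intros)
  ultimately have "GDERIV (\<lambda>x. f (x, y)) x :> fst D" "GDERIV (\<lambda>y. f (x, y)) y :> snd D"
    by (simp_all add: gderiv_def inner_prod_def)
  then show ?thesis by (simp add: saddle_op_def z GDERIV_grad_eq)
qed

text \<open>The mean value theorem along the segment gives \<open>L\<close> instead of the sharp
  \<open>L / 2\<close>. Only the quadratic order matters in what follows: for growth bounds and for
  differentiating the smoothing.\<close>

lemma Lipschitz_gradient_remainder:
  assumes gd: "\<And>w. GDERIV f w :> g w"
    and lip: "\<And>v w. norm (g v - g w) \<le> L * norm (v - w)" and L: "L \<ge> 0"
  shows "\<bar>f (w + k) - f w - k \<bullet> g w\<bar> \<le> L * (norm k)\<^sup>2"
proof -
  have "((\<lambda>t. f (w + t *\<^sub>R k)) has_derivative (\<lambda>s. (s *\<^sub>R k) \<bullet> g (w + t *\<^sub>R k))) (at t within T)" for t T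
    by (rule has_derivative_compose[where g=f and f="\<lambda>t. w + t *\<^sub>R k", OF _ gd[unfolded gderiv_def]])
      (auto intro!: derivative_eq_intros)
  from mvt_simple[of 0 1 "\<lambda>t. f (w + t *\<^sub>R k)", OF _ this]
  obtain t where t: "t \<in> {0<..<1}" "f (w + k) - f w = k \<bullet> g (w + t *\<^sub>R k)"
    by auto
  have "\<bar>k \<bullet> (g (w + t *\<^sub>R k) - g w)\<bar> \<le> norm k * (L * norm (w + t *\<^sub>R k - w))"
    by (rule order.trans[OF Cauchy_Schwarz_ineq2]) (intro mult_left_mono lip norm_ge_zero)
  also have "\<dots> = t * (L * (norm k)\<^sup>2)" using t by (simp add: power2_eq_square)
  also have "\<dots> \<le> 1 * (L * (norm k)\<^sup>2)" using t L by (intro mult_right_mono) auto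
  finally show ?thesis using t by (simp add: inner_diff_right)
qed

section \<open>Moments of the Gaussian distribution\<close>

lemma sets_gaussian [simp, measurable_cong]: "sets (gaussian lam) = sets borel"
  and space_gaussian [simp]: "space (gaussian lam) = UNIV"
  by (simp_all add: gaussian_def)

text \<open>The density factors over the coordinates. Total mass, finiteness of moments and the
  second moment all come from this formula with suitable factors.\<close>

lemma nn_integral_gaussian_prod:
  fixes f :: "'a::euclidean_space \<Rightarrow> real \<Rightarrow> ennreal"
  assumes [measurable]: "\<And>b. b \<in> Basis \<Longrightarrow> f b \<in> borel_measurable borel"
  shows "(\<integral>\<^sup>+u. (\<Prod>b\<in>Basis. f b (u \<bullet> b)) \<partial>gaussian lam)
    = (\<Prod>b\<in>Basis. \<integral>\<^sup>+x. ennreal (normal_density 0 (1 / sqrt lam) x) * f b x \<partial>lborel)"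
proof -
  have "(\<integral>\<^sup>+u. (\<Prod>b\<in>Basis. f b (u \<bullet> b)) \<partial>gaussian lam)
    = (\<integral>\<^sup>+u. (\<Prod>b\<in>Basis. ennreal (normal_density 0 (1 / sqrt lam) (u \<bullet> b)) * f b (u \<bullet> b)) \<partial>lborel)"
    unfolding gaussian_def
    by (subst nn_integral_density) (auto simp: prod_ennreal[symmetric] prod.distrib)
  also have "\<dots> = (\<Prod>b\<in>Basis. \<integral>\<^sup>+x. ennreal (normal_density 0 (1 / sqrt lam) x) * f b x \<partial>lborel)"
    by (rule nn_integral_lborel_prod) auto
  finally show ?thesis .
qed

text \<open>Replaces a bound in terms of the norm by a product over coordinates, the shape to which
  the product formula applies.\<close>

lemma one_plus_norm_le_prod: "1 + norm (u::'a::euclidean_space) \<le> (\<Prod>b\<in>Basis. 1 + \<bar>u \<bullet> b\<bar>)"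
proof -
  have "1 + (\<Sum>b\<in>S. \<bar>u \<bullet> b\<bar>) \<le> (\<Prod>b\<in>S. 1 + \<bar>u \<bullet> b\<bar>)" if "finite S" for S :: "'a set"
    using that
  proof induction
    case (insert c S)
    have "1 + (\<bar>u \<bullet> c\<bar> + (\<Sum>b\<in>S. \<bar>u \<bullet> b\<bar>)) \<le> (1 + \<bar>u \<bullet> c\<bar>) * (1 + (\<Sum>b\<in>S. \<bar>u \<bullet> b\<bar>))"
      by (simp add: algebra_simps sum_nonneg)
    also have "\<dots> \<le> (1 + \<bar>u \<bullet> c\<bar>) * (\<Prod>b\<in>S. 1 + \<bar>u \<bullet> b\<bar>)"
      using insert.IH by (intro mult_left_mono) auto
    finally show ?case using insert(1,2) by simp
  qed simp
  from this[OF finite_Basis] norm_le_l1[of u] show ?thesis by linarith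
qed

lemma normal_density_moment_finite:
  assumes "\<sigma> > 0"
  shows "(\<integral>\<^sup>+x. ennreal (normal_density 0 \<sigma> x) * ennreal ((1 + \<bar>x\<bar>) ^ k) \<partial>lborel) < \<infinity>"
proof -
  let ?n = "normal_density 0 \<sigma>"
  have "integrable lborel (\<lambda>x. 2 ^ k * (?n x * \<bar>x - 0\<bar> ^ 0 + ?n x * \<bar>x - 0\<bar> ^ k))"
    by (intro integrable_mult_right Bochner_Integration.integrable_add
        integrable_normal_moment_abs[OF assms])
  then have "integrable lborel (\<lambda>x. ?n x * (1 + \<bar>x\<bar>) ^ k)"
  proof (rule Bochner_Integration.integrable_bound)
    have "(1 + \<bar>x\<bar>) ^ k \<le> 2 ^ k * (1 + \<bar>x\<bar> ^ k)" for x :: real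
    proof -
      have "(1 + \<bar>x\<bar>) ^ k \<le> (2 * max 1 \<bar>x\<bar>) ^ k" by (intro power_mono) auto
      also have "\<dots> \<le> 2 ^ k * (1 + \<bar>x\<bar> ^ k)"
        by (auto simp: power_mult_distrib max_def)
      finally show ?thesis .
    qed
    then have "?n x * (1 + \<bar>x\<bar>) ^ k \<le> ?n x * (2 ^ k * (1 + \<bar>x\<bar> ^ k))" for x
      by (intro mult_left_mono) auto
    then show "AE x in lborel. norm (?n x * (1 + \<bar>x\<bar>) ^ k)
        \<le> norm (2 ^ k * (?n x * \<bar>x - 0\<bar> ^ 0 + ?n x * \<bar>x - 0\<bar> ^ k))"
      by (simp add: abs_mult algebra_simps)
  qed measurable
  then show ?thesis
    by (simp add: integrable_iff_bounded ennreal_mult'[symmetric] abs_mult)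
qed

context
  fixes lam :: real
  assumes lam: "lam > 0"
begin

lemma prob_space_gaussian: "prob_space (gaussian lam :: 'a::euclidean_space measure)"
proof
  have *: "(\<integral>\<^sup>+x. ennreal (normal_density 0 (1 / sqrt lam) x) \<partial>lborel) = 1"
    using lam by (subst nn_integral_eq_integral) auto
  have "emeasure (gaussian lam :: 'a measure) (space (gaussian lam))
    = (\<integral>\<^sup>+u. (\<Prod>b\<in>(Basis :: 'a set). 1) \<partial>(gaussian lam :: 'a measure))"
    by simp
  also have "\<dots> = 1"
    by (subst nn_integral_gaussian_prod[where f="\<lambda>_ _. 1"]) (auto simp: *)
  finally show "emeasure (gaussian lam :: 'a measure) (space (gaussian lam)) = 1" .
qed

text \<open>Polynomial growth is the criterion for integrability against the Gaussian from here on;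
  hence the crude bounds below by powers of \<open>1 + norm u\<close>.\<close>

lemma integrable_gaussian:
  fixes f :: "'a::euclidean_space \<Rightarrow> 'b::{banach, second_countable_topology}"
  assumes [measurable]: "f \<in> borel_measurable borel"
    and le: "\<And>u. norm (f u) \<le> C * (1 + norm u) ^ k"
  shows "integrable (gaussian lam) f"
proof -
  have "(\<integral>\<^sup>+u. ennreal ((1 + norm u) ^ k) \<partial>(gaussian lam :: 'a measure))
    \<le> (\<integral>\<^sup>+u. (\<Prod>b\<in>Basis. ennreal ((1 + \<bar>u \<bullet> b\<bar>) ^ k)) \<partial>(gaussian lam :: 'a measure))"
    by (intro nn_integral_mono)
      (auto simp: prod_ennreal prod_power_distrib[symmetric] intro!: ennreal_leI power_mono one_plus_norm_le_prod)
  also have "\<dots> < \<infinity>"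
  proof -
    have "(\<integral>\<^sup>+x. ennreal (normal_density 0 (1 / sqrt lam) x) * ennreal ((1 + \<bar>x\<bar>) ^ k) \<partial>lborel) \<noteq> top"
      using normal_density_moment_finite[of "1 / sqrt lam" k] lam by simp
    then show ?thesis
      by (subst nn_integral_gaussian_prod) (auto simp: less_top[symmetric] ennreal_prod_eq_top power_eq_top_ennreal)
  qed
  finally have "integrable (gaussian lam) (\<lambda>u::'a. (1 + norm u) ^ k)"
    by (simp add: integrable_iff_bounded)
  then have "integrable (gaussian lam) (\<lambda>u::'a. C * (1 + norm u) ^ k)"
    by (rule integrable_mult_right)
  then show ?thesis
    by (rule Bochner_Integration.integrable_bound)
      (auto intro!: AE_I2 order.trans[OF le] abs_ge_self)
qed

lemma gaussian_second_moment_Basis: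
  fixes c :: "'a::euclidean_space"
  assumes c: "c \<in> Basis"
  shows "(\<integral>u. (u \<bullet> c)\<^sup>2 \<partial>gaussian lam) = 1 / lam"
proof -
  have n: "(\<integral>\<^sup>+x. ennreal (normal_density 0 (1 / sqrt lam) x) \<partial>lborel) = 1"
    using lam by (subst nn_integral_eq_integral) auto
  \<comment> \<open>The formula for even moments at order 2; with standard deviation
    \<open>1 / sqrt lam\<close> its value is \<open>1 / lam\<close>.\<close>
  have "has_bochner_integral lborel
      (\<lambda>x. normal_density 0 (1 / sqrt lam) x * (x - 0) ^ (2 * 1)) (fact (2 * 1) / ((2 / (1 / sqrt lam)\<^sup>2) ^ 1 * fact 1))"
    using lam by (intro normal_moment_even) auto
  then have m: "(\<integral>\<^sup>+x. ennreal (normal_density 0 (1 / sqrt lam) x) * ennreal (x\<^sup>2) \<partial>lborel) = ennreal (1 / lam)"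
    using lam
    by (simp add: ennreal_mult[symmetric] power_divide has_bochner_integral_iff nn_integral_eq_integral)
  \<comment> \<open>A function of one coordinate becomes a product whose other factors are 1, so the
    remaining coordinates contribute only their total mass.\<close>
  have "(\<integral>\<^sup>+u. ennreal ((u \<bullet> c)\<^sup>2) \<partial>gaussian lam)
     = (\<integral>\<^sup>+u. (\<Prod>b\<in>Basis. (if b = c then ennreal ((u \<bullet> b)\<^sup>2) else 1)) \<partial>gaussian lam)"
    using c by (simp add: prod.delta)
  also have "\<dots> = (\<Prod>b\<in>Basis. \<integral>\<^sup>+x. ennreal (normal_density 0 (1 / sqrt lam) x)
      * (if b = c then ennreal (x\<^sup>2) else 1) \<partial>lborel)"
    by (rule nn_integral_gaussian_prod) auto
  also have "\<dots> = (\<Prod>b\<in>Basis. if b = c then ennreal (1 / lam) else 1)"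
    by (intro prod.cong refl) (simp add: n m)
  also have "\<dots> = ennreal (1 / lam)" using c by (simp add: prod.delta)
  finally show ?thesis
    using lam by (intro integral_eq_nn_integral[THEN trans]) auto
qed

lemma gaussian_second_moment:
  "(\<integral>u. (norm (u::'a::euclidean_space))\<^sup>2 \<partial>gaussian lam) = DIM('a) / lam"
proof -
  have "integrable (gaussian lam) (\<lambda>u::'a. (u \<bullet> b)\<^sup>2)" if "b \<in> Basis" for b :: 'a
  proof (rule integrable_gaussian[where C=1 and k=2])
    fix u :: 'a
    have "\<bar>u \<bullet> b\<bar> \<le> 1 + norm u" using Basis_le_norm[OF that, of u] by simp
    then show "norm ((u \<bullet> b)\<^sup>2) \<le> 1 * (1 + norm u)\<^sup>2"
      using power_mono[of "\<bar>u \<bullet> b\<bar>" "1 + norm u" 2] by simp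
  qed simp
  moreover have "(norm u)\<^sup>2 = (\<Sum>b\<in>Basis. (u \<bullet> b)\<^sup>2)" for u :: 'a
    unfolding power2_norm_eq_inner by (subst euclidean_inner) (simp add: power2_eq_square)
  ultimately show ?thesis
    by (simp add: gaussian_second_moment_Basis)
qed

end

text \<open>Nonnegativity of the variance bounds the squared mean by the second moment.\<close>

lemma (in prob_space) expectation_le_sqrt:
  assumes "integrable M (\<lambda>x. X x :: real)" "integrable M (\<lambda>x. (X x)\<^sup>2)"
    and "expectation (\<lambda>x. (X x)\<^sup>2) \<le> c\<^sup>2" "c \<ge> 0"
  shows "expectation X \<le> c"
proof -
  have "(expectation X)\<^sup>2 \<le> c\<^sup>2"
    using variance_positive[of X] variance_eq[OF assms(1,2)] assms(3) by linarith
  then show ?thesis using assms(4) by (rule power2_le_imp_le)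
qed

lemma gaussian_first_moment:
  assumes lam: "lam > 0"
  shows "(\<integral>u. norm (u::'a::euclidean_space) \<partial>gaussian lam) \<le> sqrt (DIM('a) / lam)"
proof -
  interpret prob_space "gaussian lam :: 'a measure" by (rule prob_space_gaussian[OF lam])
  show ?thesis
  proof (rule expectation_le_sqrt)
    show "integrable (gaussian lam) (norm :: 'a \<Rightarrow> real)"
      by (rule integrable_gaussian[OF lam, where C=1 and k=1]) auto
    show "integrable (gaussian lam) (\<lambda>u::'a. (norm u)\<^sup>2)"
      by (rule integrable_gaussian[OF lam, where C=1 and k=2]) (auto intro: power_mono)
  qed (use lam in \<open>simp_all add: gaussian_second_moment\<close>)
qed

section \<open>Gaussian smoothing and the oracle error\<close>

text \<open>Here \<open>L\<close> refers to the Euclidean norm on both sides; the constant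
  \<open>L1\<close> for the norms of \<open>B\<close> and its inverse corresponds to
  \<open>lam * L1\<close>.\<close>

locale Lipschitz_gradient =
  fixes f :: "'a::euclidean_space \<Rightarrow> real" and g :: "'a \<Rightarrow> 'a" and L lam \<mu> :: real
  assumes gd: "\<And>w. GDERIV f w :> g w"
    and lip: "\<And>v w. norm (g v - g w) \<le> L * norm (v - w)"
    and L: "L \<ge> 0" and lam: "lam > 0" and mu: "\<mu> > 0"
begin

lemma continuous_on_f: "continuous_on A f"
  by (rule continuous_at_imp_continuous_on)
    (intro ballI has_derivative_continuous[OF gd[unfolded gderiv_def]])

lemma continuous_on_g: "continuous_on A g"
proof -
  have "L-lipschitz_on UNIV g"
    by (rule lipschitz_onI) (simp_all only: dist_norm lip L)
  from continuous_on_subset[OF lipschitz_on_continuous_on[OF this]] show ?thesis by simp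
qed

lemma measurable_f [measurable]: "f \<in> borel_measurable borel"
  and measurable_g [measurable]: "g \<in> borel_measurable borel"
  by (rule borel_measurable_continuous_onI[OF continuous_on_f],
      rule borel_measurable_continuous_onI[OF continuous_on_g])

text \<open>The factor \<mu> is kept in front so that it cancels the division by \<mu> in the
  oracle; the linear and quadratic terms are merged into one power for the growth criterion.\<close>

lemma increment_le: "\<bar>f (z + \<mu> *\<^sub>R u) - f z\<bar> \<le> \<mu> * (norm (g z) + L * \<mu>) * (1 + norm u) ^ 2"
proof -
  have "\<bar>f (z + \<mu> *\<^sub>R u) - f z\<bar> \<le> \<bar>(\<mu> *\<^sub>R u) \<bullet> g z\<bar> + L * (norm (\<mu> *\<^sub>R u))\<^sup>2"
    using Lipschitz_gradient_remainder[OF gd lip L, of z "\<mu> *\<^sub>R u"] by linarith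
  also have "\<bar>(\<mu> *\<^sub>R u) \<bullet> g z\<bar> \<le> \<mu> * (norm u * norm (g z))"
    using mu Cauchy_Schwarz_ineq2[of u "g z"] by (simp add: abs_mult)
  also have "\<mu> * (norm u * norm (g z)) + L * (norm (\<mu> *\<^sub>R u))\<^sup>2
      = \<mu> * norm (g z) * norm u + \<mu> * (L * \<mu>) * (norm u)\<^sup>2"
    using mu by (simp add: power_mult_distrib power2_eq_square)
  also have "\<dots> \<le> \<mu> * norm (g z) * (1 + norm u)\<^sup>2 + \<mu> * (L * \<mu>) * (1 + norm u)\<^sup>2"
    using mu L by (intro add_mono mult_left_mono) (auto simp: power2_eq_square algebra_simps)
  finally show ?thesis by (simp add: algebra_simps)
qed

lemma integrable_f_shift: "integrable (gaussian lam) (\<lambda>u. f (z + \<mu> *\<^sub>R u))"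
proof (rule integrable_gaussian[OF lam, where k=2])
  fix u :: 'a
  have "\<bar>f z\<bar> * 1 \<le> \<bar>f z\<bar> * (1 + norm u)\<^sup>2" by (intro mult_left_mono) auto
  then show "norm (f (z + \<mu> *\<^sub>R u)) \<le> (\<bar>f z\<bar> + \<mu> * (norm (g z) + L * \<mu>)) * (1 + norm u)\<^sup>2"
    using increment_le[of z u] by (simp add: distrib_right)
qed simp

lemma integrable_g_shift: "integrable (gaussian lam) (\<lambda>u. g (z + \<mu> *\<^sub>R u))"
proof (rule integrable_gaussian[OF lam, where k=1])
  fix u :: 'a
  have "norm (g (z + \<mu> *\<^sub>R u)) \<le> norm (g z) + norm (g (z + \<mu> *\<^sub>R u) - g z)" by norm
  also have "\<dots> \<le> norm (g z) + L * (\<mu> * norm u)"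
    using lip[of "z + \<mu> *\<^sub>R u" z] mu by simp
  also have "\<dots> \<le> (norm (g z) + L * \<mu>) * (1 + norm u) ^ 1"
    using L mu by (simp add: algebra_simps)
  finally show "norm (g (z + \<mu> *\<^sub>R u)) \<le> (norm (g z) + L * \<mu>) * (1 + norm u) ^ 1" .
qed simp

text \<open>
  The remainder bound of \<open>f\<close> is uniform in the base point, so it survives integration; this replaces
  dominated convergence.
\<close>

lemma GDERIV_smoothing: "GDERIV (smoothing lam \<mu> f) z :> (\<integral>u. g (z + \<mu> *\<^sub>R u) \<partial>gaussian lam)"
proof -
  interpret prob_space "gaussian lam :: 'a measure" by (rule prob_space_gaussian[OF lam])
  have P1: "prob UNIV = 1" using prob_space by simp
  let ?D = "\<integral>u. g (z + \<mu> *\<^sub>R u) \<partial>gaussian lam"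
  have rem: "\<bar>smoothing lam \<mu> f y - smoothing lam \<mu> f z - (y - z) \<bullet> ?D\<bar> \<le> L * (norm (y - z))\<^sup>2" for y
  proof -
    let ?r = "\<lambda>u. f (y + \<mu> *\<^sub>R u) - f (z + \<mu> *\<^sub>R u) - (y - z) \<bullet> g (z + \<mu> *\<^sub>R u)"
    have "\<bar>smoothing lam \<mu> f y - smoothing lam \<mu> f z - (y - z) \<bullet> ?D\<bar> = \<bar>expectation ?r\<bar>"
      by (simp add: smoothing_def integrable_f_shift integrable_g_shift)
    also have "\<dots> \<le> expectation (\<lambda>u. \<bar>?r u\<bar>)"
      by (rule integral_abs_bound)
    also have "\<dots> \<le> expectation (\<lambda>u. L * (norm (y - z))\<^sup>2)"
    proof (rule integral_mono)
      show "integrable (gaussian lam) (\<lambda>u. \<bar>?r u\<bar>)"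
        by (intro integrable_abs Bochner_Integration.integrable_diff integrable_f_shift
            integrable_inner_right integrable_g_shift)
      show "\<bar>?r u\<bar> \<le> L * (norm (y - z))\<^sup>2" for u
      proof -
        have "z + \<mu> *\<^sub>R u + (y - z) = y + \<mu> *\<^sub>R u" by simp
        then show ?thesis
          using Lipschitz_gradient_remainder[OF gd lip L, of "z + \<mu> *\<^sub>R u" "y - z"] by (simp only:)
      qed
    qed simp
    finally show ?thesis by (simp add: P1)
  qed
  show ?thesis
    unfolding gderiv_def
  proof (rule has_derivativeI_sandwich[of 1])
    show "norm (smoothing lam \<mu> f y - smoothing lam \<mu> f z - (y - z) \<bullet> ?D) / norm (y - z)
        \<le> L * norm (y - z)" if "y \<noteq> z" for y
    proof -
      have "norm (y - z) > 0" using that by simp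
      then show ?thesis
        using rem[of y] by (simp only: pos_divide_le_eq real_norm_def power2_eq_square mult.assoc)
    qed
    show "((\<lambda>y. L * norm (y - z)) \<longlongrightarrow> 0) (at z)"
    proof -
      have "((\<lambda>y. L * norm (y - z)) \<longlongrightarrow> L * norm (z - z)) (at z)"
        by (intro tendsto_intros)
      then show ?thesis by (simp only: diff_self norm_zero mult_zero_right)
    qed
  qed (auto intro: bounded_linear_inner_left)
qed

text \<open>The gradient of the smoothing is the Gaussian average of \<open>g\<close>, so the
  Lipschitz condition reduces the bias to the first moment of the Gaussian. It grows only like the
  square root of the dimension.\<close>

lemma smoothing_bias: "norm (grad (smoothing lam \<mu> f) z - g z) \<le> L * \<mu> * sqrt (DIM('a) / lam)"
proof -
  interpret prob_space "gaussian lam :: 'a measure" by (rule prob_space_gaussian[OF lam])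
  have i: "integrable (gaussian lam) (norm :: 'a \<Rightarrow> real)"
    by (rule integrable_gaussian[OF lam, where C=1 and k=1]) auto
  have "grad (smoothing lam \<mu> f) z - g z = expectation (\<lambda>u. g (z + \<mu> *\<^sub>R u) - g z)"
    by (simp add: GDERIV_grad_eq[OF GDERIV_smoothing] integrable_g_shift prob_space[simplified])
  also have "norm \<dots> \<le> expectation (\<lambda>u. norm (g (z + \<mu> *\<^sub>R u) - g z))"
    by (rule integral_norm_bound)
  also have "\<dots> \<le> expectation (\<lambda>u. L * \<mu> * norm u)"
  proof (rule integral_mono)
    show "integrable (gaussian lam) (\<lambda>u. norm (g (z + \<mu> *\<^sub>R u) - g z))"
      by (intro integrable_norm Bochner_Integration.integrable_diff integrable_g_shift) simp
    show "norm (g (z + \<mu> *\<^sub>R u) - g z) \<le> L * \<mu> * norm u" for u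
      using lip[of "z + \<mu> *\<^sub>R u" z] mu by simp
  qed (use i in simp)
  also have "\<dots> \<le> L * \<mu> * sqrt (DIM('a) / lam)"
    using gaussian_first_moment[OF lam, where 'a='a] L mu by (simp add: mult_left_mono)
  finally show ?thesis .
qed

end

text \<open>The sign change in the second block is an isometry, so the Lipschitz and bias bounds for
  the gradient carry over to the saddle operator.\<close>

lemma norm_saddle_reflection: "norm (fst w, - snd w) = norm w"
  by (simp add: norm_prod_def)

section \<open>The oracle as a noisy and biased saddle operator\<close>

locale saddle_oracle = Lipschitz_gradient f g L lam \<mu>
  for f :: "('a::euclidean_space \<times> 'b::euclidean_space) \<Rightarrow> real" and g L lam \<mu> +
  fixes \<sigma> :: real
  assumes sigma: "\<sigma> \<ge> 0"
    and variance: "\<And>w. (\<integral>v. (dnormB lam (zo_oracle lam \<mu> f w v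
                          - saddle_op (smoothing lam \<mu> f) w))\<^sup>2 \<partial>(gaussian lam)) \<le> \<sigma>\<^sup>2"
begin

definition bias :: real where
  "bias = L * \<mu> * sqrt (DIM('a \<times> 'b) / lam)"

lemma bias_nonneg: "bias \<ge> 0"
  using L mu lam by (simp add: bias_def)

lemma saddle_op_f: "saddle_op f w = (fst (g w), - snd (g w))"
  by (rule saddle_op_eq[OF gd])

lemma norm_saddle_op_diff: "norm (saddle_op f v - saddle_op f w) \<le> L * norm (v - w)"
proof -
  have "saddle_op f v - saddle_op f w = (fst (g v - g w), - snd (g v - g w))"
    by (simp add: saddle_op_f)
  then show ?thesis using lip[of v w] by (simp only: norm_saddle_reflection)
qed

lemma norm_saddle_op_smoothing_diff:
  "norm (saddle_op (smoothing lam \<mu> f) w - saddle_op f w) \<le> bias"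
proof -
  have "saddle_op (smoothing lam \<mu> f) w - saddle_op f w
    = (fst (grad (smoothing lam \<mu> f) w - g w), - snd (grad (smoothing lam \<mu> f) w - g w))"
    by (simp add: saddle_op_f saddle_op_eq[OF GDERIV_smoothing] GDERIV_grad_eq[OF GDERIV_smoothing])
  then show ?thesis
    using smoothing_bias[of w] by (simp only: norm_saddle_reflection bias_def)
qed

lemma continuous_on_saddle_op: "continuous_on UNIV (saddle_op f)"
  unfolding saddle_op_f[abs_def]
  by (intro continuous_intros continuous_on_g)

lemma measurable_saddle_op [measurable]: "saddle_op f \<in> borel_measurable borel"
  using continuous_on_saddle_op by (rule borel_measurable_continuous_onI)

lemma measurable_zo_oracle [measurable]:
  "(\<lambda>(w, v). zo_oracle lam \<mu> f w v) \<in> borel_measurable (borel \<Otimes>\<^sub>M borel)"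
proof -
  have "continuous_on UNIV (\<lambda>(w, v). zo_oracle lam \<mu> f w v)"
    unfolding zo_oracle_def case_prod_unfold using mu
    by (intro continuous_intros continuous_on_compose2[OF continuous_on_f[of UNIV]]) auto
  then show ?thesis
    unfolding borel_prod by (rule borel_measurable_continuous_onI)
qed

lemma norm_zo_oracle_le:
  "norm (zo_oracle lam \<mu> f w v) \<le> lam * (norm (g w) + L * \<mu>) * (1 + norm v) ^ 3"
proof -
  have "(lam *\<^sub>R fst v, - (lam *\<^sub>R snd v)) = lam *\<^sub>R (fst v, - snd v)"
    by (simp only: scaleR_Pair scaleR_minus_right)
  then have "norm (zo_oracle lam \<mu> f w v) = \<bar>f (w + \<mu> *\<^sub>R v) - f w\<bar> / \<mu> * (lam * norm v)"
    using mu lam by (simp only: zo_oracle_def norm_scaleR norm_saddle_reflection abs_divide abs_of_pos)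
  also have "\<dots> \<le> (\<mu> * (norm (g w) + L * \<mu>) * (1 + norm v)\<^sup>2) / \<mu> * (lam * (1 + norm v))"
  proof (rule mult_mono)
    show "\<bar>f (w + \<mu> *\<^sub>R v) - f w\<bar> / \<mu> \<le> \<mu> * (norm (g w) + L * \<mu>) * (1 + norm v)\<^sup>2 / \<mu>"
      using mu by (intro divide_right_mono increment_le) simp
  qed (use mu lam L in auto)
  also have "\<dots> = lam * (norm (g w) + L * \<mu>) * ((1 + norm v)\<^sup>2 * (1 + norm v))"
    using mu by (simp only: mult.assoc mult.commute mult.left_commute nonzero_mult_div_cancel_left)
  also have "(1 + norm v)\<^sup>2 * (1 + norm v) = (1 + norm v) ^ 3"
    by (simp only: power3_eq_cube power2_eq_square)
  finally show ?thesis .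
qed

text \<open>The error is at most the deviation \<open>X\<close> of the oracle from the smoothed
  operator, controlled by the variance, plus the deterministic bias. Nonnegative integrals are used
  because \<open>w\<close> later becomes random and is handled by Tonelli.\<close>

lemma oracle_error_moments:
  defines "e \<equiv> \<lambda>w v. norm (zo_oracle lam \<mu> f w v - saddle_op f w)"
  shows "(\<integral>\<^sup>+v. ennreal ((e w v)\<^sup>2) \<partial>gaussian lam) \<le> ennreal (2 * lam * \<sigma>\<^sup>2 + 2 * bias\<^sup>2)"
    and "(\<integral>\<^sup>+v. ennreal (e w v) \<partial>gaussian lam) \<le> ennreal (sqrt lam * \<sigma> + bias)"
proof -
  interpret prob_space "gaussian lam :: ('a \<times> 'b) measure" by (rule prob_space_gaussian[OF lam])
  have P1: "prob UNIV = 1" using prob_space by simp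
  define c where "c = saddle_op (smoothing lam \<mu> f) w"
  define X where "X v = norm (zo_oracle lam \<mu> f w v - c)" for v
  have [measurable]: "zo_oracle lam \<mu> f w \<in> borel_measurable borel"
    using measurable_Pair2[OF measurable_zo_oracle, of w] by simp
  have [measurable]: "X \<in> borel_measurable borel"
    unfolding X_def by measurable
  define C where "C = lam * (norm (g w) + L * \<mu>) + norm c"
  have C: "X v \<le> C * (1 + norm v) ^ 3" for v
  proof -
    have "norm c * 1 \<le> norm c * (1 + norm v) ^ 3" by (intro mult_left_mono one_le_power) auto
    with norm_zo_oracle_le[of w v] show ?thesis
      using norm_triangle_ineq4[of "zo_oracle lam \<mu> f w v" c]
      by (simp add: X_def C_def distrib_right)
  qed
  have X0: "X v \<ge> 0" for v by (simp add: X_def)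
  \<comment> \<open>A Bochner integral of a nonintegrable function is 0 by default, which would make
    the variance hypothesis say nothing. The cubic growth of the oracle rules this out; the square
    of \<open>X\<close> has growth of order 6.\<close>
  have iX: "integrable (gaussian lam) X"
    by (rule integrable_gaussian[OF lam, where C=C and k=3]) (use C X0 in auto)
  have iX2: "integrable (gaussian lam) (\<lambda>v. (X v)\<^sup>2)"
    by (rule integrable_gaussian[OF lam, where C="C\<^sup>2" and k=6])
      (use power_mono[OF C X0, of _ 2] in \<open>simp_all add: power_mult_distrib flip: power_mult\<close>)
  have "expectation (\<lambda>v. (X v)\<^sup>2 / lam) \<le> \<sigma>\<^sup>2"
    using variance[of w] lam by (simp add: X_def c_def dnormB_eq power_divide)
  then have EX2: "expectation (\<lambda>v. (X v)\<^sup>2) \<le> lam * \<sigma>\<^sup>2"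
    using lam by (simp add: field_simps)
  have EX: "expectation X \<le> sqrt lam * \<sigma>"
    by (rule expectation_le_sqrt[OF iX iX2]) (use EX2 sigma lam in \<open>simp_all add: power_mult_distrib\<close>)
  have e: "e w v \<le> X v + bias" for v
  proof -
    have "e w v \<le> X v + norm (c - saddle_op f w)" unfolding e_def X_def by norm
    then show ?thesis using norm_saddle_op_smoothing_diff[of w] by (simp add: c_def)
  qed
  have e0: "e w v \<ge> 0" for v by (simp add: e_def)
  have "(\<integral>\<^sup>+v. ennreal (e w v) \<partial>gaussian lam) \<le> (\<integral>\<^sup>+v. ennreal (X v + bias) \<partial>gaussian lam)"
    by (intro nn_integral_mono ennreal_leI e)
  also have "\<dots> = ennreal (expectation (\<lambda>v. X v + bias))"
    using iX X0 bias_nonneg by (intro nn_integral_eq_integral) auto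
  also have "expectation (\<lambda>v. X v + bias) \<le> sqrt lam * \<sigma> + bias"
    using iX EX by (simp add: P1)
  finally show "(\<integral>\<^sup>+v. ennreal (e w v) \<partial>gaussian lam) \<le> ennreal (sqrt lam * \<sigma> + bias)"
    by (simp add: ennreal_leI)
  have e2: "(e w v)\<^sup>2 \<le> 2 * (X v)\<^sup>2 + 2 * bias\<^sup>2" for v
  proof -
    have "(e w v)\<^sup>2 \<le> (X v + bias)\<^sup>2" using e e0 by (intro power_mono) auto
    also have "\<dots> \<le> 2 * (X v)\<^sup>2 + 2 * bias\<^sup>2"
      using sum_squares_bound[of "X v" bias] by (simp add: power2_sum)
    finally show ?thesis .
  qed
  have "(\<integral>\<^sup>+v. ennreal ((e w v)\<^sup>2) \<partial>gaussian lam)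
      \<le> (\<integral>\<^sup>+v. ennreal (2 * (X v)\<^sup>2 + 2 * bias\<^sup>2) \<partial>gaussian lam)"
    by (intro nn_integral_mono ennreal_leI e2)
  also have "\<dots> = ennreal (expectation (\<lambda>v. 2 * (X v)\<^sup>2 + 2 * bias\<^sup>2))"
    using iX2 by (intro nn_integral_eq_integral) auto
  also have "expectation (\<lambda>v. 2 * (X v)\<^sup>2 + 2 * bias\<^sup>2) \<le> 2 * lam * \<sigma>\<^sup>2 + 2 * bias\<^sup>2"
    using iX2 EX2 by (simp add: P1)
  finally show "(\<integral>\<^sup>+v. ennreal ((e w v)\<^sup>2) \<partial>gaussian lam) \<le> ennreal (2 * lam * \<sigma>\<^sup>2 + 2 * bias\<^sup>2)"
    by (simp add: ennreal_leI)
qed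

end

section \<open>Choice of the smoothing parameter\<close>

text \<open>The bound on \<mu> is the positive root of
  \<open>a * t\<^sup>2 + b * t = \<epsilon>\<^sup>2 / 4\<close>; completing the square avoids any
  discussion of roots.\<close>

lemma quadratic_root_bound:
  fixes a b \<mu> \<epsilon> :: real
  assumes "a > 0" "b \<ge> 0" "\<mu> \<ge> 0" "\<mu> \<le> (- b + sqrt (b\<^sup>2 + a * \<epsilon>\<^sup>2)) / (2 * a)"
  shows "a * \<mu>\<^sup>2 + b * \<mu> \<le> \<epsilon>\<^sup>2 / 4"
proof -
  have "2 * a * \<mu> + b \<le> sqrt (b\<^sup>2 + a * \<epsilon>\<^sup>2)"
    using assms by (simp add: field_simps)
  then have "(2 * a * \<mu> + b)\<^sup>2 \<le> (sqrt (b\<^sup>2 + a * \<epsilon>\<^sup>2))\<^sup>2"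
    using assms by (intro power_mono) auto
  then have "(2 * a * \<mu> + b)\<^sup>2 \<le> b\<^sup>2 + a * \<epsilon>\<^sup>2"
    using assms by simp
  then have "a * (4 * (a * \<mu>\<^sup>2 + b * \<mu>)) \<le> a * \<epsilon>\<^sup>2"
    by (simp add: power2_eq_square algebra_simps)
  then show ?thesis using assms(1) by simp
qed

text \<open>Compares the dimension factor of the bias with the one in the condition on \<mu>. The
  gained factor 1/2 becomes the 1/4 in the bound on \<open>\<beta>\<^sup>2\<close>.\<close>

lemma sqrt_le_three_halves_power:
  assumes "(d::real) \<ge> 1"
  shows "sqrt d \<le> (d + 3) powr (3 / 2) / 2"
proof -
  have "(d + 3) powr (3 / 2) = (d + 3) powr 1 * (d + 3) powr (1 / 2)"
    by (simp only: powr_add[symmetric]) simp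
  then have "(d + 3) powr (3 / 2) = (d + 3) * sqrt (d + 3)"
    using assms by (simp add: powr_half_sqrt)
  moreover have "2 * sqrt d \<le> (d + 3) * sqrt (d + 3)"
    using assms by (intro mult_mono) auto
  ultimately show ?thesis by simp
qed

text \<open>
  Here \<open>T\<close> stands for \<open>L1 \<mu> (d + 3) powr (3 / 2)\<close>, \<open>R\<close> for \<open>r0\<^sup>2\<close> and \<open>n\<close> for \<open>N + 1\<close>. The
  assumption \<open>a \<mu>\<^sup>2 + b \<mu> \<le> \<epsilon>\<^sup>2 / 4\<close> has the term \<open>b \<mu>\<close> proportional to \<open>Dz * T\<close>, so the lower bound on \<open>Dz\<close>
  bounds \<open>T\<close> itself by a multiple of \<open>\<epsilon> * \<kappa>\<close>.
\<close>

lemma complexity_arithmetic: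
  fixes lam L1 h \<rho> Dz T \<epsilon> \<sigma> \<beta> R n \<kappa> c V V1 :: real
  assumes pos: "lam > 0" "L1 > 0" "h > 0" "\<rho> > 0" "\<epsilon> > 0" "\<sigma> \<ge> 0" "T \<ge> 0" "n > 0"
    and kappa: "\<kappa> = lam\<^sup>2 * L1 * h\<^sup>2 - 6 * \<rho>" "\<kappa> > 0"
    and h_le: "h \<le> 1 / (2 * L1 * lam)"
    and c: "c = \<kappa> / (lam\<^sup>2 * L1)"
    and V: "V = 2 * lam * \<sigma>\<^sup>2 + 2 * \<beta>\<^sup>2" and V1: "V1 = sqrt lam * \<sigma> + \<beta>"
    and beta: "0 \<le> \<beta>" "\<beta> \<le> sqrt lam * T / 2"
    and Dz: "Dz > sqrt lam * h * \<epsilon>"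
    and T: "4 * \<rho> * lam * T\<^sup>2 / \<kappa> + 4 * lam * Dz * T / \<kappa> \<le> \<epsilon>\<^sup>2 / 4"
    and n: "16 * lam\<^sup>2 * L1 * R / \<kappa> \<le> \<epsilon>\<^sup>2 * n"
  shows "4 / c * (R / n + (8 * h\<^sup>2 * V + 2 * h * (Dz / sqrt lam) * V1 + (2 * h * \<rho> / lam + c / 2) * V))
    \<le> \<epsilon>\<^sup>2 + (4 * (36 * \<rho> + 4 / L1) / \<kappa> + 4) * lam * \<sigma>\<^sup>2 + 8 * Dz * lam * \<sigma> / \<kappa>"
proof -
  define s where "s = sqrt lam"
  have s: "s > 0" "lam = s\<^sup>2" "sqrt lam = s" using pos by (auto simp: s_def)
  \<comment> \<open>The step size in units of the reciprocal Lipschitz constant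
    \<open>lam * L1\<close>. In these terms
    \<open>L1 * \<kappa> = y\<^sup>2 - 6 * \<rho> * L1\<close>.\<close>
  define y where "y = lam * L1 * h"
  have y: "y > 0" "y \<le> 1 / 2" "y\<^sup>2 \<le> 1 / 4"
  proof -
    show "y > 0" using pos by (simp add: y_def)
    show "y \<le> 1 / 2" using h_le pos by (simp add: y_def field_simps)
    then show "y\<^sup>2 \<le> 1 / 4" using \<open>y > 0\<close> power_mono[of y "1 / 2" 2] by (simp add: power_divide)
  qed
  have kappa_le: "L1 * \<kappa> \<le> y\<^sup>2"
    using pos by (simp add: kappa y_def power_mult_distrib power2_eq_square algebra_simps)
  have Dz0: "Dz > 0" using Dz pos s by (meson less_trans mult_pos_pos real_sqrt_gt_zero)
  have beta2: "\<beta>\<^sup>2 \<le> lam * T\<^sup>2 / 4"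
    using power_mono[OF beta(2,1), of 2] pos by (simp add: power_mult_distrib power_divide)
  have T0: "4 * \<rho> * lam * T\<^sup>2 / \<kappa> \<ge> 0" "4 * lam * Dz * T / \<kappa> \<ge> 0"
    using pos kappa(2) Dz0 by simp_all
  \<comment> \<open>Parts \<open>iii\<close> and \<open>iv\<close> below produce exactly one half of
    each of the two nonnegative summands in the assumption on \<open>T\<close>.\<close>
  have half: "x / 2 \<le> \<epsilon>\<^sup>2 / 8" if "x + x' \<le> \<epsilon>\<^sup>2 / 4" "x' \<ge> 0" for x x'
    using that by simp
  note TA = half[OF T T0(2)] and TB = half[OF T[unfolded add.commute[of "4 * \<rho> * lam * T\<^sup>2 / \<kappa>"]] T0(1)]
  have "16 * (lam * s * h * T) \<le> \<epsilon> * \<kappa>"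
  proof -
    have "16 * (lam * (s * h * \<epsilon>) * T) \<le> 16 * (lam * Dz * T)"
      using Dz pos s by (intro mult_left_mono mult_right_mono) auto
    also have "\<dots> \<le> \<epsilon>\<^sup>2 * \<kappa>"
      using T T0(1) kappa(2) by (simp add: field_simps)
    finally show ?thesis using pos by (simp add: power2_eq_square)
  qed
  then have "(16 * (lam * s * h * T))\<^sup>2 \<le> (\<epsilon> * \<kappa>)\<^sup>2"
    using pos s by (intro power_mono) auto
  then have T2: "256 * (lam\<^sup>2 * h\<^sup>2 * (lam * T\<^sup>2)) \<le> \<epsilon>\<^sup>2 * \<kappa>\<^sup>2"
    by (simp add: power_mult_distrib s(2)[symmetric] mult.assoc mult.left_commute)
  have "256 * (y\<^sup>2 * (lam * T\<^sup>2)) = L1\<^sup>2 * (256 * (lam\<^sup>2 * h\<^sup>2 * (lam * T\<^sup>2)))"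
    by (simp add: y_def power_mult_distrib)
  also have "\<dots> \<le> L1\<^sup>2 * (\<epsilon>\<^sup>2 * \<kappa>\<^sup>2)"
    using T2 by (intro mult_left_mono) auto
  also have "\<dots> = \<epsilon>\<^sup>2 * (L1 * \<kappa>)\<^sup>2" by (simp add: power_mult_distrib)
  also have "\<dots> = \<epsilon>\<^sup>2 * (L1 * \<kappa>) * (L1 * \<kappa>)" by (simp add: power2_eq_square)
  finally have yT: "256 * (y\<^sup>2 * (lam * T\<^sup>2)) \<le> \<epsilon>\<^sup>2 * (L1 * \<kappa>) * (L1 * \<kappa>)" .
  \<comment> \<open>The constant 16 in the bound on \<open>n\<close> is 4 from \<open>4 / c\<close>
    times 4 for the quarter of \<open>\<epsilon>\<^sup>2\<close>.\<close>
  have i: "4 / c * (R / n) \<le> \<epsilon>\<^sup>2 / 4"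
    using n pos kappa(2) by (simp add: c field_simps)
  have ii: "4 / c * (8 * h\<^sup>2 * V) \<le> 16 / L1 / \<kappa> * lam * \<sigma>\<^sup>2 + \<epsilon>\<^sup>2 / 64"
  proof -
    have "4 / c * (8 * h\<^sup>2 * V) = 64 * y\<^sup>2 / (L1 * \<kappa>) * (lam * \<sigma>\<^sup>2) + 64 * y\<^sup>2 / (L1 * \<kappa>) * \<beta>\<^sup>2"
      using pos kappa(2) by (simp add: c V y_def field_simps power2_eq_square)
    also have "64 * y\<^sup>2 / (L1 * \<kappa>) * (lam * \<sigma>\<^sup>2) \<le> 16 / (L1 * \<kappa>) * (lam * \<sigma>\<^sup>2)"
      using y pos kappa(2) by (intro mult_right_mono divide_right_mono) auto
    also have "64 * y\<^sup>2 / (L1 * \<kappa>) * \<beta>\<^sup>2 \<le> 64 * y\<^sup>2 / (L1 * \<kappa>) * (lam * T\<^sup>2 / 4)"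
      using beta2 pos kappa(2) by (intro mult_left_mono) auto
    also have "\<dots> = 256 * (y\<^sup>2 * (lam * T\<^sup>2)) / (16 * (L1 * \<kappa>))" by simp
    also have "\<dots> \<le> \<epsilon>\<^sup>2 * (L1 * \<kappa>) * (L1 * \<kappa>) / (16 * (L1 * \<kappa>))"
      using yT pos kappa(2) by (intro divide_right_mono) auto
    also have "\<dots> = \<epsilon>\<^sup>2 * (L1 * \<kappa>) / 16" using pos kappa(2) by simp
    also have "\<dots> \<le> \<epsilon>\<^sup>2 * (1 / 4) / 16"
      using kappa_le y by (intro divide_right_mono mult_left_mono) auto
    finally show ?thesis by simp
  qed
  have iii: "4 / c * (2 * h * (Dz / sqrt lam) * V1) \<le> 4 * Dz * lam * \<sigma> / \<kappa> + \<epsilon>\<^sup>2 / 8"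
  proof -
    have "4 / c * (2 * h * (Dz / sqrt lam) * V1) = 8 * y * (s * Dz * V1 / \<kappa>)"
      using pos kappa(2) s(1) by (simp add: c y_def s(2,3) field_simps power2_eq_square)
    also have "\<dots> \<le> 4 * (s * Dz * V1 / \<kappa>)"
      using y pos kappa(2) s Dz0 beta V1 by (intro mult_right_mono) auto
    also have "\<dots> \<le> 4 * (s * Dz * (s * \<sigma> + s * T / 2) / \<kappa>)"
      using pos kappa(2) s Dz0 beta V1 by (intro mult_left_mono divide_right_mono) auto
    also have "\<dots> = 4 * Dz * lam * \<sigma> / \<kappa> + (4 * lam * Dz * T / \<kappa>) / 2"
      using kappa(2) by (simp add: s(2) field_simps power2_eq_square)
    also note add_left_mono[OF TB]
    finally show ?thesis .
  qed
  have iv: "4 / c * (2 * h * \<rho> / lam * V) \<le> 8 * \<rho> / \<kappa> * lam * \<sigma>\<^sup>2 + \<epsilon>\<^sup>2 / 8"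
  proof -
    have V0: "V \<ge> 0" using pos by (simp add: V)
    have "4 / c * (2 * h * \<rho> / lam * V) = 8 * y * (\<rho> * V / \<kappa>)"
      using pos kappa(2) by (simp add: c y_def field_simps power2_eq_square)
    also have "\<dots> \<le> 4 * (\<rho> * V / \<kappa>)"
      using y pos kappa(2) V0 by (intro mult_right_mono) auto
    also have "\<dots> \<le> 4 * (\<rho> * (2 * lam * \<sigma>\<^sup>2 + 2 * (lam * T\<^sup>2 / 4)) / \<kappa>)"
      unfolding V using pos kappa(2) beta2
      by (intro mult_left_mono divide_right_mono add_left_mono) auto
    also have "\<dots> = 8 * \<rho> / \<kappa> * lam * \<sigma>\<^sup>2 + (4 * \<rho> * lam * T\<^sup>2 / \<kappa>) / 2"
      using kappa(2) by (simp add: field_simps)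
    also note add_left_mono[OF TA]
    finally show ?thesis .
  qed
  have v: "4 / c * (c / 2 * V) \<le> 4 * lam * \<sigma>\<^sup>2 + \<epsilon>\<^sup>2 / 64"
  proof -
    \<comment> \<open>This bias term has no factor \<open>y\<^sup>2\<close>. Bounding both factors
      \<open>L1 * \<kappa>\<close> by \<open>y\<^sup>2\<close> leaves a spare
      \<open>y\<^sup>2\<close> on the right, so the common one cancels and \<open>T\<close> is
      bounded independently of \<kappa>.\<close>
    have "y\<^sup>2 * (256 * (lam * T\<^sup>2)) \<le> \<epsilon>\<^sup>2 * (L1 * \<kappa>) * (L1 * \<kappa>)"
      using yT by (simp add: mult.left_commute)
    also have "\<dots> \<le> \<epsilon>\<^sup>2 * y\<^sup>2 * y\<^sup>2"
      using kappa_le pos kappa(2) by (intro mult_mono) auto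
    also have "\<dots> \<le> \<epsilon>\<^sup>2 * y\<^sup>2 * (1 / 4)"
      using y by (intro mult_left_mono) auto
    also have "\<dots> = y\<^sup>2 * (\<epsilon>\<^sup>2 * (1 / 4))" by simp
    finally have "256 * (lam * T\<^sup>2) \<le> \<epsilon>\<^sup>2 * (1 / 4)" using y by simp
    moreover have "4 / c * (c / 2 * V) = 4 * lam * \<sigma>\<^sup>2 + 4 * \<beta>\<^sup>2"
      using pos kappa(2) by (simp add: c V field_simps)
    ultimately show ?thesis using beta2 zero_le_power2[of \<epsilon>] by linarith
  qed
  have "4 / c * (R / n + (8 * h\<^sup>2 * V + 2 * h * (Dz / sqrt lam) * V1 + (2 * h * \<rho> / lam + c / 2) * V))
    = 4 / c * (R / n) + 4 / c * (8 * h\<^sup>2 * V) + 4 / c * (2 * h * (Dz / sqrt lam) * V1)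
      + 4 / c * (2 * h * \<rho> / lam * V) + 4 / c * (c / 2 * V)"
    by (simp only: distrib_left distrib_right add.assoc)
  also have "\<dots> \<le> \<epsilon>\<^sup>2 / 4 + (16 / L1 / \<kappa> * lam * \<sigma>\<^sup>2 + \<epsilon>\<^sup>2 / 64) + (4 * Dz * lam * \<sigma> / \<kappa> + \<epsilon>\<^sup>2 / 8)
      + (8 * \<rho> / \<kappa> * lam * \<sigma>\<^sup>2 + \<epsilon>\<^sup>2 / 8) + (4 * lam * \<sigma>\<^sup>2 + \<epsilon>\<^sup>2 / 64)"
    by (intro add_mono i ii iii iv v)
  \<comment> \<open>The shares of \<open>\<epsilon>\<^sup>2\<close> add up to 17/32. The noise terms
    fit as well: 8 against 144 for the \<rho> term, 4 against 8 for the \<open>Dz\<close> term,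
    while the other two match exactly.\<close>
  also have "\<dots> \<le> \<epsilon>\<^sup>2 + (16 / L1 / \<kappa> * lam * \<sigma>\<^sup>2 + 144 * (\<rho> / \<kappa> * lam * \<sigma>\<^sup>2) + 4 * lam * \<sigma>\<^sup>2)
      + 2 * (4 * Dz * lam * \<sigma> / \<kappa>)"
  proof -
    have *: "e / 4 + (p + e / 64) + (q + e / 8) + (r + e / 8) + (w + e / 64) \<le> e + (p + 144 * t + w) + 2 * q"
      if "t \<ge> 0" "q \<ge> 0" "e \<ge> 0" "r = 8 * t" for e p q r t w :: real
      using that by simp
    show ?thesis
      by (rule *) (use pos kappa(2) Dz0 in simp_all)
  qed
  also have "\<dots> = \<epsilon>\<^sup>2 + (4 * (36 * \<rho> + 4 / L1) / \<kappa> + 4) * lam * \<sigma>\<^sup>2 + 8 * Dz * lam * \<sigma> / \<kappa>"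
    using pos kappa(2) by (simp add: field_simps)
  finally show ?thesis .
qed

section \<open>Independence of the samples and the averaged bound\<close>

text \<open>Replaces conditioning on the past: a function of the block \<open>A\<close> is
  independent of \<open>X i\<close>, so their joint law is a product, and Tonelli integrates the
  fresh sample first at a fixed point, where the bound is uniform.\<close>

lemma (in prob_space) nn_integral_fresh_sample_le:
  fixes \<psi> :: "'b \<Rightarrow> 'b \<Rightarrow> ennreal"
  assumes indep: "indep_vars (\<lambda>_. N) X I" and A: "A \<subseteq> I" "i \<in> I" "i \<notin> A"
    and \<phi>: "\<phi> \<in> PiM A (\<lambda>_. N) \<rightarrow>\<^sub>M K"
    and \<psi>: "case_prod \<psi> \<in> borel_measurable (K \<Otimes>\<^sub>M N)"
    and le: "\<And>w. (\<integral>\<^sup>+v. \<psi> w v \<partial>distr M N (X i)) \<le> C"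
  shows "(\<integral>\<^sup>+\<omega>. \<psi> (\<phi> (\<lambda>j\<in>A. X j \<omega>)) (X i \<omega>) \<partial>M) \<le> C"
proof -
  define W where "W \<omega> = \<phi> (\<lambda>j\<in>A. X j \<omega>)" for \<omega>
  have "indep_var (PiM A (\<lambda>_. N)) (\<lambda>\<omega>. \<lambda>j\<in>A. X j \<omega>) (PiM {i} (\<lambda>_. N)) (\<lambda>\<omega>. \<lambda>j\<in>{i}. X j \<omega>)"
    using A by (intro indep_var_restrict[OF indep]) auto
  then have "indep_var K (\<phi> \<circ> (\<lambda>\<omega>. \<lambda>j\<in>A. X j \<omega>)) N ((\<lambda>x. x i) \<circ> (\<lambda>\<omega>. \<lambda>j\<in>{i}. X j \<omega>))"
    by (rule indep_var_compose) (simp_all add: \<phi>)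
  moreover have "\<phi> \<circ> (\<lambda>\<omega>. \<lambda>j\<in>A. X j \<omega>) = W" "(\<lambda>x. x i) \<circ> (\<lambda>\<omega>. \<lambda>j\<in>{i}. X j \<omega>) = X i"
    by (simp_all add: W_def fun_eq_iff)
  ultimately have "indep_var K W N (X i)" by simp
  then have W [measurable]: "W \<in> M \<rightarrow>\<^sub>M K" and X [measurable]: "X i \<in> M \<rightarrow>\<^sub>M N"
    and eq: "distr M K W \<Otimes>\<^sub>M distr M N (X i) = distr M (K \<Otimes>\<^sub>M N) (\<lambda>\<omega>. (W \<omega>, X i \<omega>))"
    by (auto simp: indep_var_distribution_eq)
  interpret W: prob_space "distr M K W" by (rule prob_space_distr[OF W])
  interpret Xi: prob_space "distr M N (X i)" by (rule prob_space_distr[OF X])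
  have "(\<integral>\<^sup>+\<omega>. \<psi> (W \<omega>) (X i \<omega>) \<partial>M) = (\<integral>\<^sup>+p. case_prod \<psi> p \<partial>distr M (K \<Otimes>\<^sub>M N) (\<lambda>\<omega>. (W \<omega>, X i \<omega>)))"
    using \<psi> by (subst nn_integral_distr) auto
  also have "\<dots> = (\<integral>\<^sup>+w. \<integral>\<^sup>+v. \<psi> w v \<partial>distr M N (X i) \<partial>distr M K W)"
    unfolding eq[symmetric] using \<psi> by (subst Xi.nn_integral_fst[symmetric]) simp_all
  also have "\<dots> \<le> (\<integral>\<^sup>+w. C \<partial>distr M K W)"
    by (intro nn_integral_mono le)
  also have "\<dots> = C" using W.emeasure_space_1 by simp
  finally show ?thesis by (simp add: W_def)
qed

lemma integrable_and_integral_le: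
  fixes X :: "'a \<Rightarrow> real"
  assumes "X \<in> borel_measurable M" "\<And>x. x \<in> space M \<Longrightarrow> 0 \<le> X x"
    and "(\<integral>\<^sup>+x. ennreal (X x) \<partial>M) \<le> ennreal C" "C \<ge> 0"
  shows "integrable M X" "integral\<^sup>L M X \<le> C"
proof -
  have AE: "AE x in M. 0 \<le> X x" using assms(2) by auto
  have "(\<integral>\<^sup>+x. ennreal (X x) \<partial>M) < \<infinity>"
    using assms(3) by (rule le_less_trans) simp
  then show "integrable M X" using assms(1) AE by (intro integrableI_nonneg) auto
  then have "ennreal (integral\<^sup>L M X) \<le> ennreal C"
    using nn_integral_eq_integral AE assms(3) by metis
  then show "integral\<^sup>L M X \<le> C" using assms(4) by simp
qed

text \<open>The iterates as a function of the samples, indexed by \<open>Inl k\<close> for \<open>uh k\<close> and \<open>Inr k\<close> for \<open>u k\<close>.\<close>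

primrec sample_path :: "('a \<Rightarrow> 's \<Rightarrow> 's \<Rightarrow> 'a) \<Rightarrow> 'a \<Rightarrow> nat \<Rightarrow> (nat + nat \<Rightarrow> 's) \<Rightarrow> 'a" where
  "sample_path T z0 0 x = z0"
| "sample_path T z0 (Suc k) x = T (sample_path T z0 k x) (x (Inl k)) (x (Inr k))"

text \<open>\<open>A\<close> may be larger than the set of indices read. This keeps the product
  space fixed during the induction and later admits the extra index \<open>Inl k\<close> of the half
  step.\<close>

lemma measurable_sample_path:
  assumes T: "(\<lambda>(z, v, w). T z v w) \<in> K \<Otimes>\<^sub>M N \<Otimes>\<^sub>M N \<rightarrow>\<^sub>M K"
    and z0: "z0 \<in> space K" and A: "{..<k} <+> {..<k} \<subseteq> A"
  shows "sample_path T z0 k \<in> PiM A (\<lambda>_. N) \<rightarrow>\<^sub>M K"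
  using A
proof (induction k)
  case 0
  show ?case using z0 by (simp add: sample_path.simps(1)[abs_def])
next
  case (Suc k)
  have k: "Inl k \<in> A" "Inr k \<in> A" "{..<k} <+> {..<k} \<subseteq> A" using Suc.prems by auto
  have "(\<lambda>x. (sample_path T z0 k x, x (Inl k), x (Inr k))) \<in> PiM A (\<lambda>_. N) \<rightarrow>\<^sub>M K \<Otimes>\<^sub>M N \<Otimes>\<^sub>M N"
    using k by (intro measurable_Pair Suc.IH measurable_component_singleton) auto
  from measurable_compose[OF this T] show ?case
    by (simp add: sample_path.simps(2)[abs_def])
qed

text \<open>The path up to \<open>k\<close> reads only earlier samples, so restricting them to that
  block, with \<open>undefined\<close> outside, changes nothing.\<close>

lemma sample_path_cong:
  assumes "\<And>j. j < k \<Longrightarrow> x (Inl j) = y (Inl j) \<and> x (Inr j) = y (Inr j)"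
  shows "sample_path T z0 k x = sample_path T z0 k y"
  using assms by (induction k) auto

section \<open>One run of the algorithm with random samples\<close>

locale zo_eg_run = saddle_oracle f g L lam \<mu> \<sigma> + prob_space M
  for f :: "('a::euclidean_space \<times> 'b::euclidean_space) \<Rightarrow> real" and g L lam \<mu> \<sigma>
    and M :: "'w measure" +
  fixes Z :: "('a \<times> 'b) set" and z0 zs :: "'a \<times> 'b" and h \<rho> D c :: real and N :: nat
    and u uh z zh :: "nat \<Rightarrow> 'w \<Rightarrow> 'a \<times> 'b"
  assumes Z: "convex Z" "closed Z" "Z \<noteq> {}"
    and diam: "\<And>v w. v \<in> Z \<Longrightarrow> w \<in> Z \<Longrightarrow> norm (v - w) \<le> D"
    and z0: "z0 \<in> Z" and zs: "zs \<in> Z"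
    and mvi: "prox_weak_MVI lam (saddle_op f) Z \<rho> zs"
    and h: "h > 0" and Lh: "L * h \<le> 1 / 2" and rho: "\<rho> \<ge> 0"
    and c: "c > 0" "c + 9 * h * \<rho> / lam \<le> h\<^sup>2"
    and indep: "indep_vars (\<lambda>_. borel) (case_sum uh u) ({..N} <+> {..N})"
    and uh_distr: "\<And>k. k \<le> N \<Longrightarrow> distr M borel (uh k) = gaussian lam"
    and u_distr: "\<And>k. k \<le> N \<Longrightarrow> distr M borel (u k) = gaussian lam"
    and algorithm: "\<And>\<omega>. \<omega> \<in> space M \<Longrightarrow>
          zo_eg lam \<mu> f Z (\<lambda>_. h) (\<lambda>_. h) N z0
            (\<lambda>k. uh k \<omega>) (\<lambda>k. u k \<omega>) (\<lambda>k. zh k \<omega>) (\<lambda>k. z k \<omega>)"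
begin

abbreviation "G \<equiv> zo_oracle lam \<mu> f"
abbreviation "F \<equiv> saddle_op f"

definition half_step :: "'a \<times> 'b \<Rightarrow> 'a \<times> 'b \<Rightarrow> 'a \<times> 'b" where
  "half_step w v = proj lam Z (w - h *\<^sub>R G w v)"

definition full_step :: "'a \<times> 'b \<Rightarrow> 'a \<times> 'b \<Rightarrow> 'a \<times> 'b \<Rightarrow> 'a \<times> 'b" where
  "full_step w v v' = proj lam Z (w - h *\<^sub>R G (half_step w v) v')"

abbreviation "iterate \<equiv> sample_path full_step z0"
abbreviation "samples \<omega> \<equiv> \<lambda>i. case_sum uh u i \<omega>"

lemma measurable_proj [measurable]: "proj lam Z \<in> borel_measurable borel"
  using continuous_on_proj[OF lam Z] by (rule borel_measurable_continuous_onI)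

lemma measurable_half_step: "(\<lambda>(w, v). half_step w v) \<in> borel \<Otimes>\<^sub>M borel \<rightarrow>\<^sub>M borel"
proof -
  note [measurable] = measurable_compose[OF _ measurable_zo_oracle, of "\<lambda>x. (fst x, snd x)", simplified]
  show ?thesis
    unfolding half_step_def case_prod_unfold by measurable
qed

lemma measurable_full_step:
  "(\<lambda>(w, v, v'). full_step w v v') \<in> borel \<Otimes>\<^sub>M borel \<Otimes>\<^sub>M borel \<rightarrow>\<^sub>M borel"
proof -
  have [measurable]: "(\<lambda>x. half_step (fst x) (fst (snd x))) \<in> borel \<Otimes>\<^sub>M borel \<Otimes>\<^sub>M (borel :: ('a \<times> 'b) measure) \<rightarrow>\<^sub>M borel"
  proof -
    have "(\<lambda>x. (fst x, fst (snd x))) \<in> borel \<Otimes>\<^sub>M borel \<Otimes>\<^sub>M (borel :: ('a \<times> 'b) measure) \<rightarrow>\<^sub>M borel \<Otimes>\<^sub>M borel"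
      by measurable
    from measurable_compose[OF this measurable_half_step] show ?thesis by simp
  qed
  have [measurable]: "(\<lambda>x. G (half_step (fst x) (fst (snd x))) (snd (snd x)))
      \<in> borel \<Otimes>\<^sub>M borel \<Otimes>\<^sub>M borel \<rightarrow>\<^sub>M borel"
  proof -
    have "(\<lambda>x. (half_step (fst x) (fst (snd x)), snd (snd x)))
        \<in> borel \<Otimes>\<^sub>M borel \<Otimes>\<^sub>M (borel :: ('a \<times> 'b) measure) \<rightarrow>\<^sub>M borel \<Otimes>\<^sub>M borel"
      by measurable
    from measurable_compose[OF this measurable_zo_oracle] show ?thesis by simp
  qed
  show ?thesis
    unfolding full_step_def case_prod_unfold by measurable
qed

lemma z_eq_iterate:
  assumes "\<omega> \<in> space M" "k \<le> Suc N"
  shows "z k \<omega> = iterate k (samples \<omega>)"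
  using assms(2)
proof (induction k)
  case 0
  then show ?case using algorithm[OF assms(1)] by (simp add: zo_eg_def)
next
  case (Suc k)
  then show ?case using algorithm[OF assms(1)] by (simp add: zo_eg_def full_step_def half_step_def)
qed

lemma zh_eq_half_step:
  assumes "\<omega> \<in> space M" "k \<le> N"
  shows "zh k \<omega> = half_step (z k \<omega>) (uh k \<omega>)"
  using algorithm[OF assms(1)] assms(2) by (simp add: zo_eg_def half_step_def)

lemma z_in:
  assumes "\<omega> \<in> space M" "k \<le> Suc N"
  shows "z k \<omega> \<in> Z"
proof (cases k)
  case 0
  then show ?thesis using algorithm[OF assms(1)] z0 by (simp add: zo_eg_def)
next
  case (Suc j)
  then show ?thesis using algorithm[OF assms(1)] assms(2) proj_in[OF lam Z] by (simp add: zo_eg_def)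
qed

lemma measurable_uh [measurable]: "k \<le> N \<Longrightarrow> uh k \<in> borel_measurable M"
  and measurable_u [measurable]: "k \<le> N \<Longrightarrow> u k \<in> borel_measurable M"
  using indep unfolding indep_vars_def2 by (force dest: bspec[of _ _ "Inl k"], force dest: bspec[of _ _ "Inr k"])

text \<open>The iterates are given only as functions satisfying the recursion. Measurability follows
  since on \<open>space M\<close> they agree with a Borel function of finitely many samples.\<close>

lemma measurable_z:
  assumes k: "k \<le> Suc N"
  shows "z k \<in> borel_measurable M"
proof -
  let ?A = "{..<k} <+> {..<k}"
  have "(\<lambda>\<omega>. \<lambda>i\<in>?A. samples \<omega> i) \<in> M \<rightarrow>\<^sub>M PiM ?A (\<lambda>_. borel)"
    using k by (intro measurable_restrict) (auto split: sum.split intro: measurable_uh measurable_u)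
  from measurable_compose[OF this measurable_sample_path[OF measurable_full_step]]
  have "(\<lambda>\<omega>. iterate k (\<lambda>i\<in>?A. samples \<omega> i)) \<in> borel_measurable M" by simp
  moreover have "z k \<omega> = iterate k (\<lambda>i\<in>?A. samples \<omega> i)" if "\<omega> \<in> space M" for \<omega>
    unfolding z_eq_iterate[OF that k] by (rule sample_path_cong) auto
  ultimately show ?thesis by (simp cong: measurable_cong)
qed

lemma measurable_zh:
  assumes k: "k \<le> N"
  shows "zh k \<in> borel_measurable M"
proof -
  have "(\<lambda>\<omega>. (z k \<omega>, uh k \<omega>)) \<in> M \<rightarrow>\<^sub>M borel \<Otimes>\<^sub>M borel"
    using measurable_z[of k] measurable_uh[OF k] k by simp
  from measurable_compose[OF this measurable_half_step]
  have "(\<lambda>\<omega>. half_step (z k \<omega>) (uh k \<omega>)) \<in> borel_measurable M" by simp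
  then show ?thesis using zh_eq_half_step[OF _ k] by (simp cong: measurable_cong)
qed

definition err :: "'a \<times> 'b \<Rightarrow> 'a \<times> 'b \<Rightarrow> real" where
  "err w v = norm (G w v - F w)"

lemma err_nonneg: "err w v \<ge> 0"
  by (simp add: err_def)

lemma measurable_err: "case_prod err \<in> borel_measurable (borel \<Otimes>\<^sub>M borel)"
proof -
  have "(\<lambda>x. norm (case_prod G x - F (fst x))) \<in> borel_measurable (borel \<Otimes>\<^sub>M borel)"
    by measurable
  then show ?thesis by (simp add: err_def case_prod_unfold)
qed

definition "V = 2 * lam * \<sigma>\<^sup>2 + 2 * bias\<^sup>2"
definition "V1 = sqrt lam * \<sigma> + bias"

lemma V_nonneg: "V \<ge> 0" "V1 \<ge> 0"
  using lam sigma bias_nonneg by (simp_all add: V_def V1_def)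

lemma half_step_error:
  assumes k: "k \<le> N"
  shows "integrable M (\<lambda>\<omega>. (err (z k \<omega>) (uh k \<omega>))\<^sup>2)"
    and "expectation (\<lambda>\<omega>. (err (z k \<omega>) (uh k \<omega>))\<^sup>2) \<le> V"
proof -
  \<comment> \<open>\<open>z k\<close> reads both kinds of samples strictly before \<open>k\<close>,
    so \<open>uh k\<close> is fresh for it.\<close>
  let ?A = "{..<k} <+> {..<k}"
  have [measurable]: "(\<lambda>\<omega>. err (z k \<omega>) (uh k \<omega>)) \<in> borel_measurable M"
    using measurable_compose[OF measurable_Pair[OF measurable_z measurable_uh] measurable_err] k by simp
  have "(\<integral>\<^sup>+\<omega>. ennreal ((err (z k \<omega>) (uh k \<omega>))\<^sup>2) \<partial>M)
      = (\<integral>\<^sup>+\<omega>. ennreal ((err (iterate k (\<lambda>i\<in>?A. samples \<omega> i)) (samples \<omega> (Inl k)))\<^sup>2) \<partial>M)"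
  proof (rule nn_integral_cong)
    fix \<omega> assume "\<omega> \<in> space M"
    moreover have "iterate k (samples \<omega>) = iterate k (\<lambda>i\<in>?A. samples \<omega> i)"
      by (rule sample_path_cong) auto
    ultimately show "ennreal ((err (z k \<omega>) (uh k \<omega>))\<^sup>2)
        = ennreal ((err (iterate k (\<lambda>i\<in>?A. samples \<omega> i)) (samples \<omega> (Inl k)))\<^sup>2)"
      using k by (simp only: z_eq_iterate sum.case le_SucI)
  qed
  also have "\<dots> \<le> ennreal V"
  proof (rule nn_integral_fresh_sample_le[OF indep])
    show "iterate k \<in> PiM ?A (\<lambda>_. borel) \<rightarrow>\<^sub>M borel"
      by (rule measurable_sample_path[OF measurable_full_step]) auto
    show "(\<lambda>(w, v). ennreal ((err w v)\<^sup>2)) \<in> borel_measurable (borel \<Otimes>\<^sub>M borel)"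
      using measurable_err by (simp add: case_prod_unfold)
    show "(\<integral>\<^sup>+v. ennreal ((err w v)\<^sup>2) \<partial>distr M borel (case_sum uh u (Inl k))) \<le> ennreal V" for w
      using oracle_error_moments(1)[of w] by (simp add: uh_distr[OF k] err_def V_def)
  qed (use k in auto)
  finally show "integrable M (\<lambda>\<omega>. (err (z k \<omega>) (uh k \<omega>))\<^sup>2)"
    "expectation (\<lambda>\<omega>. (err (z k \<omega>) (uh k \<omega>))\<^sup>2) \<le> V"
    by (auto intro!: integrable_and_integral_le V_nonneg)
qed

lemma full_step_error:
  assumes k: "k \<le> N"
  shows "integrable M (\<lambda>\<omega>. (err (zh k \<omega>) (u k \<omega>))\<^sup>2)"
    and "expectation (\<lambda>\<omega>. (err (zh k \<omega>) (u k \<omega>))\<^sup>2) \<le> V"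
    and "integrable M (\<lambda>\<omega>. err (zh k \<omega>) (u k \<omega>))"
    and "expectation (\<lambda>\<omega>. err (zh k \<omega>) (u k \<omega>)) \<le> V1"
proof -
  \<comment> \<open>The half step also reads \<open>uh k\<close>, so the past of \<open>zh k\<close>
    contains \<open>Inl k\<close> but not \<open>Inr k\<close>, and \<open>u k\<close> is still
    fresh.\<close>
  let ?A = "{..k} <+> {..<k}"
  define \<phi> where "\<phi> x = half_step (iterate k x) (x (Inl k))" for x
  have "(\<lambda>x. (iterate k x, x (Inl k))) \<in> PiM ?A (\<lambda>_. borel) \<rightarrow>\<^sub>M borel \<Otimes>\<^sub>M borel"
    by (intro measurable_Pair measurable_sample_path[OF measurable_full_step]
        measurable_component_singleton) auto
  from measurable_compose[OF this measurable_half_step]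
  have \<phi>: "\<phi> \<in> PiM ?A (\<lambda>_. borel) \<rightarrow>\<^sub>M borel" by (simp add: \<phi>_def[abs_def])
  have zh: "zh k \<omega> = \<phi> (\<lambda>i\<in>?A. samples \<omega> i)" if "\<omega> \<in> space M" for \<omega>
  proof -
    have "iterate k (samples \<omega>) = iterate k (\<lambda>i\<in>?A. samples \<omega> i)"
      by (rule sample_path_cong) auto
    then show ?thesis
      using that k by (simp add: \<phi>_def zh_eq_half_step z_eq_iterate InlI)
  qed
  have fresh: "(\<integral>\<^sup>+\<omega>. \<psi> (zh k \<omega>) (u k \<omega>) \<partial>M) \<le> C"
    if "case_prod \<psi> \<in> borel_measurable (borel \<Otimes>\<^sub>M borel)"
      "\<And>w. (\<integral>\<^sup>+v. \<psi> w v \<partial>gaussian lam) \<le> C" for \<psi> and C :: ennreal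
  proof -
    have "(\<integral>\<^sup>+\<omega>. \<psi> (zh k \<omega>) (u k \<omega>) \<partial>M)
        = (\<integral>\<^sup>+\<omega>. \<psi> (\<phi> (\<lambda>i\<in>?A. samples \<omega> i)) (samples \<omega> (Inr k)) \<partial>M)"
      by (intro nn_integral_cong) (simp only: zh sum.case)
    also have "\<dots> \<le> C"
      by (rule nn_integral_fresh_sample_le[OF indep _ _ _ \<phi> that(1)])
        (use k in \<open>auto simp: u_distr that(2)\<close>)
    finally show ?thesis .
  qed
  have [measurable]: "(\<lambda>\<omega>. err (zh k \<omega>) (u k \<omega>)) \<in> borel_measurable M"
    using measurable_compose[OF measurable_Pair[OF measurable_zh measurable_u] measurable_err] k by simp
  have "(\<integral>\<^sup>+\<omega>. ennreal ((err (zh k \<omega>) (u k \<omega>))\<^sup>2) \<partial>M) \<le> ennreal V"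
    using measurable_err oracle_error_moments(1)
    by (intro fresh) (simp_all add: case_prod_unfold err_def V_def)
  then show "integrable M (\<lambda>\<omega>. (err (zh k \<omega>) (u k \<omega>))\<^sup>2)"
    "expectation (\<lambda>\<omega>. (err (zh k \<omega>) (u k \<omega>))\<^sup>2) \<le> V"
    by (auto intro!: integrable_and_integral_le V_nonneg)
  have "(\<integral>\<^sup>+\<omega>. ennreal (err (zh k \<omega>) (u k \<omega>)) \<partial>M) \<le> ennreal V1"
    using measurable_err oracle_error_moments(2)
    by (intro fresh) (simp_all add: case_prod_unfold err_def V1_def)
  then show "integrable M (\<lambda>\<omega>. err (zh k \<omega>) (u k \<omega>))"
    "expectation (\<lambda>\<omega>. err (zh k \<omega>) (u k \<omega>)) \<le> V1"
    by (auto intro!: integrable_and_integral_le V_nonneg err_nonneg)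
qed

abbreviation "residual k \<omega> \<equiv> prox_grad lam Z (z k \<omega>) h (F (z k \<omega>))"

text \<open>The iterate and its projected step both lie in \<open>Z\<close>. The bound gives
  integrability of the residual and settles the case of small diameter.\<close>

lemma norm_residual_le:
  assumes "\<omega> \<in> space M" "k \<le> N"
  shows "norm (residual k \<omega>) \<le> D / h"
proof -
  have "norm (residual k \<omega>) = norm (z k \<omega> - proj lam Z (z k \<omega> - h *\<^sub>R F (z k \<omega>))) / h"
    using h by (simp add: prox_grad_def)
  also have "\<dots> \<le> D / h"
    using h z_in[OF assms(1)] assms(2) by (intro divide_right_mono diam proj_in[OF lam Z]) auto
  finally show ?thesis .
qed

lemma measurable_residual:
  assumes k: "k \<le> N"
  shows "residual k \<in> borel_measurable M"
proof -
  have [measurable]: "z k \<in> borel_measurable M" using k by (intro measurable_z) simp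
  show ?thesis unfolding prox_grad_def by measurable
qed

lemma integrable_residual:
  assumes k: "k \<le> N"
  shows "integrable M (\<lambda>\<omega>. (norm (residual k \<omega>))\<^sup>2)"
proof (rule integrable_const_bound[where B = "(D / h)\<^sup>2"])
  show "AE \<omega> in M. norm ((norm (residual k \<omega>))\<^sup>2) \<le> (D / h)\<^sup>2"
    using norm_residual_le[OF _ k] by (intro AE_I2) (simp add: power_mono)
qed (use measurable_residual[OF k] in measurable)

lemma integrable_distance:
  assumes k: "k \<le> Suc N"
  shows "integrable M (\<lambda>\<omega>. (norm (z k \<omega> - zs))\<^sup>2)"
proof (rule integrable_const_bound[where B = "D\<^sup>2"])
  show "AE \<omega> in M. norm ((norm (z k \<omega> - zs))\<^sup>2) \<le> D\<^sup>2"
    using diam[OF z_in[OF _ k] zs] by (intro AE_I2) (simp add: power_mono)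
qed (use measurable_z[OF k] in measurable)

lemma diam_nonneg: "D \<ge> 0"
  using diam[OF zs zs] by simp

lemma expected_step:
  assumes k: "k \<le> N"
  shows "c / 4 * expectation (\<lambda>\<omega>. (norm (residual k \<omega>))\<^sup>2)
    \<le> expectation (\<lambda>\<omega>. (norm (z k \<omega> - zs))\<^sup>2) - expectation (\<lambda>\<omega>. (norm (z (Suc k) \<omega> - zs))\<^sup>2)
      + (8 * h\<^sup>2 * V + 2 * h * D * V1 + (2 * h * \<rho> / lam + c / 2) * V)"
proof -
  let ?e = "\<lambda>\<omega>. err (zh k \<omega>) (u k \<omega>)" and ?eh = "\<lambda>\<omega>. err (z k \<omega>) (uh k \<omega>)"
  let ?d = "\<lambda>k \<omega>. (norm (z k \<omega> - zs))\<^sup>2"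
  note int = full_step_error(1,3)[OF k] half_step_error(1)[OF k] integrable_residual[OF k]
    integrable_distance[of k] integrable_distance[of "Suc k"]
  have "c / 4 * expectation (\<lambda>\<omega>. (norm (residual k \<omega>))\<^sup>2)
      = expectation (\<lambda>\<omega>. c / 4 * (norm (residual k \<omega>))\<^sup>2)"
    using int by simp
  also have "\<dots> \<le> expectation (\<lambda>\<omega>. ?d k \<omega> - ?d (Suc k) \<omega> + 4 * h\<^sup>2 * ((?e \<omega>)\<^sup>2 + (?eh \<omega>)\<^sup>2)
      + 2 * h * D * ?e \<omega> + (2 * h * \<rho> / lam + c / 2) * (?eh \<omega>)\<^sup>2)"
  proof (rule integral_mono)
    fix \<omega> assume \<omega>: "\<omega> \<in> space M"
    show "c / 4 * (norm (residual k \<omega>))\<^sup>2 \<le> ?d k \<omega> - ?d (Suc k) \<omega>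
        + 4 * h\<^sup>2 * ((?e \<omega>)\<^sup>2 + (?eh \<omega>)\<^sup>2) + 2 * h * D * ?e \<omega>
        + (2 * h * \<rho> / lam + c / 2) * (?eh \<omega>)\<^sup>2"
      by (rule extragradient_step[OF lam Z mvi h zs z_in norm_saddle_op_diff Lh L rho diam,
            where Gh = "G (z k \<omega>) (uh k \<omega>)" and G = "G (zh k \<omega>) (u k \<omega>)"])
        (use \<omega> k c algorithm[OF \<omega>] in \<open>auto simp: zo_eg_def err_def\<close>)
  qed (use int k in simp_all)
  also have "\<dots> = expectation (?d k) - expectation (?d (Suc k))
      + 4 * h\<^sup>2 * (expectation (\<lambda>\<omega>. (?e \<omega>)\<^sup>2) + expectation (\<lambda>\<omega>. (?eh \<omega>)\<^sup>2))
      + 2 * h * D * expectation ?e + (2 * h * \<rho> / lam + c / 2) * expectation (\<lambda>\<omega>. (?eh \<omega>)\<^sup>2)"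
    using int k by simp
  \<comment> \<open>All coefficients of the error moments are nonnegative, so the uniform bounds
    \<open>V\<close> and \<open>V1\<close> may be inserted.\<close>
  also have "\<dots> \<le> expectation (?d k) - expectation (?d (Suc k)) + 4 * h\<^sup>2 * (V + V)
      + 2 * h * D * V1 + (2 * h * \<rho> / lam + c / 2) * V"
    using half_step_error(2)[OF k] full_step_error(2,4)[OF k] h lam rho c(1) diam_nonneg
    by (intro add_mono mult_left_mono order_refl) auto
  finally show ?thesis by simp
qed

lemma average_residual_le:
  "1 / (real N + 1) * (\<Sum>k=0..N. expectation (\<lambda>\<omega>. (norm (residual k \<omega>))\<^sup>2))
    \<le> 4 / c * ((norm (z0 - zs))\<^sup>2 / (real N + 1)
        + (8 * h\<^sup>2 * V + 2 * h * D * V1 + (2 * h * \<rho> / lam + c / 2) * V))"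
proof -
  let ?r = "\<lambda>k. expectation (\<lambda>\<omega>. (norm (residual k \<omega>))\<^sup>2)"
  let ?d = "\<lambda>k. expectation (\<lambda>\<omega>. (norm (z k \<omega> - zs))\<^sup>2)"
  define C where "C = 8 * h\<^sup>2 * V + 2 * h * D * V1 + (2 * h * \<rho> / lam + c / 2) * V"
  have "c / 4 * (\<Sum>k=0..N. ?r k) = (\<Sum>k=0..N. c / 4 * ?r k)"
    by (rule sum_distrib_left)
  also have "\<dots> \<le> (\<Sum>k=0..N. ?d k - ?d (Suc k) + C)"
    unfolding C_def by (intro sum_mono expected_step) simp
  also have "\<dots> = ?d 0 - ?d (Suc N) + (real N + 1) * C"
    by (simp only: sum.distrib sum_telescope[of ?d N, folded atLeast0AtMost] sum_constant) simp
  also have "?d 0 = (norm (z0 - zs))\<^sup>2"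
  proof -
    have "?d 0 = expectation (\<lambda>\<omega>. (norm (z0 - zs))\<^sup>2)"
      using z_eq_iterate[of _ 0] by (intro Bochner_Integration.integral_cong) auto
    then show ?thesis by (simp add: prob_space)
  qed
  also have "\<dots> - ?d (Suc N) + (real N + 1) * C \<le> (norm (z0 - zs))\<^sup>2 + (real N + 1) * C"
    by simp
  finally have "c / 4 * (\<Sum>k=0..N. ?r k) \<le> (norm (z0 - zs))\<^sup>2 + (real N + 1) * C" .
  then have "4 / c * (c / 4 * (\<Sum>k=0..N. ?r k)) / (real N + 1)
      \<le> 4 / c * ((norm (z0 - zs))\<^sup>2 + (real N + 1) * C) / (real N + 1)"
    using c(1) by (intro divide_right_mono mult_left_mono) auto
  moreover have "4 / c * (c / 4 * S) / (real N + 1) = 1 / (real N + 1) * S" for S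
    using c(1) by simp
  moreover have "4 / c * (R + (real N + 1) * B) / (real N + 1) = 4 / c * (R / (real N + 1) + B)" for R B
    by (simp add: field_simps)
  ultimately show ?thesis by (simp add: C_def)
qed

end

section \<open>Passage from the weighted norms to the Euclidean estimates\<close>

theorem corollary7:
  fixes f :: "(real^'n) \<times> (real^'m) \<Rightarrow> real"
    and X :: "(real^'n) set" and Y :: "(real^'m) set"
    and Z :: "((real^'n) \<times> (real^'m)) set"
    and z0 zs :: "(real^'n) \<times> (real^'m)"
    and lam L1 \<mu> \<sigma> \<rho> h \<epsilon> d Dz r0 a b :: real
    and N :: nat
    and M :: "'w measure"
    and u uh z zh p :: "nat \<Rightarrow> 'w \<Rightarrow> (real^'n) \<times> (real^'m)"
  assumes d_eq: "d = real CARD('n) + real CARD('m)"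
    and lam_pos: "lam > 0"
    and f_diff: "\<And>w. f differentiable (at w)"
    and f_C1: "continuous_on UNIV (grad f)"
    and L1_pos: "L1 > 0"
    and f_Lip: "\<And>w1 w2. dnormB lam (grad f w1 - grad f w2) \<le> L1 * normB lam (w1 - w2)"
    and Z_prod: "Z = X \<times> Y"
    and Z_ne: "Z \<noteq> {}" and Z_compact: "compact Z" and Z_convex: "convex Z"
    and Dz_eq: "Dz = Sup {normB lam (w1 - w2) | w1 w2. w1 \<in> Z \<and> w2 \<in> Z}"
    and mu_pos: "\<mu> > 0"
    and sigma_nonneg: "\<sigma> \<ge> 0"
    and variance: "\<And>w. (\<integral>v. (dnormB lam (zo_oracle lam \<mu> f w v
                          - saddle_op (smoothing lam \<mu> f) w))\<^sup>2 \<partial>(gaussian lam)) \<le> \<sigma>\<^sup>2"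
    and rho_pos: "0 < \<rho>" and rho_less: "\<rho> < 1 / (24 * L1)"
    and zs_in: "zs \<in> Z"
    and weak_MVI: "prox_weak_MVI lam (saddle_op f) Z \<rho> zs"
    and z0_in: "z0 \<in> Z"
    and prob: "prob_space M"
    and indep: "prob_space.indep_vars M (\<lambda>_. borel) (case_sum uh u) ({..N} <+> {..N})"
    and uh_distr: "\<And>k. k \<le> N \<Longrightarrow> distr M borel (uh k) = gaussian lam"
    and u_distr: "\<And>k. k \<le> N \<Longrightarrow> distr M borel (u k) = gaussian lam"
    and algorithm: "\<And>\<omega>. \<omega> \<in> space M \<Longrightarrow>
          zo_eg lam \<mu> f Z (\<lambda>_. h) (\<lambda>_. h) N z0
            (\<lambda>k. uh k \<omega>) (\<lambda>k. u k \<omega>) (\<lambda>k. zh k \<omega>) (\<lambda>k. z k \<omega>)"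
    and h_gt: "sqrt (6 * \<rho> / (L1 * lam\<^sup>2)) < h" and h_le: "h \<le> 1 / (2 * L1 * lam)"
    and p_eq: "\<And>k \<omega>. k \<le> N \<Longrightarrow> \<omega> \<in> space M \<Longrightarrow>
          p k \<omega> = prox_grad lam Z (z k \<omega>) h (saddle_op f (z k \<omega>))"
    and r0_eq: "r0 = norm (z0 - zs)"
    and a_eq: "a = 4 * \<rho> * lam * L1\<^sup>2 * (d + 3) ^ 3 / (lam\<^sup>2 * L1 * h\<^sup>2 - 6 * \<rho>)"
    and b_eq: "b = 4 * lam * L1 * Dz * (d + 3) powr (3 / 2) / (lam\<^sup>2 * L1 * h\<^sup>2 - 6 * \<rho>)"
    and eps_pos: "\<epsilon> > 0"
    and mu_le: "\<mu> \<le> min ((- b + sqrt (b\<^sup>2 + a * \<epsilon>\<^sup>2)) / (2 * a))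
                         (\<epsilon> / (sqrt 2 * lam * L1 * (d + 3) powr (3 / 2)))"
    and N_ge: "int N \<ge> \<lceil>(16 * lam\<^sup>2 * L1 * r0\<^sup>2 / (lam\<^sup>2 * L1 * h\<^sup>2 - 6 * \<rho>)) * (1 / \<epsilon>\<^sup>2) - 1\<rceil>"
  shows "1 / (real N + 1) * (\<Sum>k=0..N. prob_space.expectation M (\<lambda>\<omega>. (norm (p k \<omega>))\<^sup>2))
          \<le> \<epsilon>\<^sup>2
            + (4 * (36 * \<rho> + 4 / L1) / (lam\<^sup>2 * L1 * h\<^sup>2 - 6 * \<rho>) + 4) * lam * \<sigma>\<^sup>2
            + 8 * Dz * lam * \<sigma> / (lam\<^sup>2 * L1 * h\<^sup>2 - 6 * \<rho>)"
proof -
  define \<kappa> where "\<kappa> = lam\<^sup>2 * L1 * h\<^sup>2 - 6 * \<rho>"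
  define c where "c = \<kappa> / (lam\<^sup>2 * L1)"
  define D where "D = Dz / sqrt lam"
  define T where "T = L1 * \<mu> * (d + 3) powr (3 / 2)"
  define S where "S = {normB lam (w1 - w2) | w1 w2. w1 \<in> Z \<and> w2 \<in> Z}"
  have d1: "d \<ge> 1" using d_eq zero_less_card_finite[where 'a='n] by linarith
  have h0: "h > 0"
    using h_gt rho_pos L1_pos lam_pos
    by (intro le_less_trans[OF _ h_gt]) simp
  \<comment> \<open>Squaring the lower bound on \<open>h\<close> is exactly positivity of
    \<kappa>.\<close>
  have kappa0: "\<kappa> > 0"
  proof -
    have "(sqrt (6 * \<rho> / (L1 * lam\<^sup>2)))\<^sup>2 < h\<^sup>2"
      using h_gt rho_pos L1_pos lam_pos by (intro power_strict_mono) auto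
    then show ?thesis
      using rho_pos L1_pos lam_pos by (simp add: \<kappa>_def field_simps)
  qed
  \<comment> \<open>The real supremum \<open>Dz\<close> bounds the distances only because
    compactness makes their set bounded above.\<close>
  have bdd: "bdd_above S"
  proof -
    obtain B where B: "\<And>w. w \<in> Z \<Longrightarrow> norm w \<le> B"
      using compact_imp_bounded[OF Z_compact] by (auto simp: bounded_iff)
    have "normB lam (v - w) \<le> sqrt lam * (B + B)" if "v \<in> Z" "w \<in> Z" for v w
      unfolding normB_eq using lam_pos B[OF that(1)] B[OF that(2)] norm_triangle_ineq4[of v w]
      by (intro mult_left_mono) auto
    then show ?thesis unfolding S_def by (intro bdd_aboveI) auto
  qed
  have diam: "norm (v - w) \<le> D" if "v \<in> Z" "w \<in> Z" for v w
  proof -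
    have "normB lam (v - w) \<in> S" unfolding S_def using that by blast
    then have "normB lam (v - w) \<le> Dz"
      unfolding Dz_eq S_def[symmetric] using bdd by (rule cSup_upper)
    then show ?thesis using lam_pos by (simp add: normB_eq D_def field_simps)
  qed
  interpret prob_space M by (rule prob)
  \<comment> \<open>Each of the two weighted norms contributes a factor \<open>sqrt lam\<close>,
    which turns \<open>L1\<close> into \<open>lam * L1\<close>.\<close>
  interpret saddle_oracle f "grad f" "lam * L1" lam \<mu> \<sigma>
  proof
    show "GDERIV f w :> grad f w" for w by (rule GDERIV_grad[OF f_diff])
    show "norm (grad f v - grad f w) \<le> lam * L1 * norm (v - w)" for v w
    proof -
      have "norm (grad f v - grad f w) \<le> L1 * (sqrt lam * norm (v - w)) * sqrt lam"
        using f_Lip[of v w] lam_pos by (simp add: normB_eq dnormB_eq pos_divide_le_eq)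
      moreover have "L1 * (sqrt lam * norm (v - w)) * sqrt lam = lam * L1 * norm (v - w)"
        using lam_pos by simp
      ultimately show ?thesis by simp
    qed
  qed (use lam_pos L1_pos mu_pos sigma_nonneg variance in auto)
  have c0: "c > 0" using kappa0 lam_pos L1_pos by (simp add: c_def)
  \<comment> \<open>The upper bound on \<open>h\<close> turns the loss into 9/2 times
    \<open>\<rho> / (lam\<^sup>2 * L1)\<close>, and the 6 in \<kappa> leaves room for it.\<close>
  have "c + 9 * h * \<rho> / lam \<le> h\<^sup>2"
  proof -
    have "9 * h * \<rho> / lam \<le> 9 * (1 / (2 * L1 * lam)) * \<rho> / lam"
      using h_le rho_pos lam_pos by (intro divide_right_mono mult_right_mono mult_left_mono) auto
    also have "\<dots> = 9 / 2 * (\<rho> / (lam\<^sup>2 * L1))" by (simp add: power2_eq_square)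
    also have "\<dots> \<le> 6 * (\<rho> / (lam\<^sup>2 * L1))"
      using rho_pos lam_pos L1_pos by (intro mult_right_mono) auto
    also have "\<dots> = h\<^sup>2 - c" using lam_pos L1_pos by (simp add: c_def \<kappa>_def field_simps)
    finally show ?thesis by simp
  qed
  then interpret zo_eg_run f "grad f" "lam * L1" lam \<mu> \<sigma> M Z z0 zs h \<rho> D c N u uh z zh
    using Z_convex compact_imp_closed[OF Z_compact] Z_ne diam z0_in zs_in weak_MVI h0 h_le rho_pos c0
      indep uh_distr u_distr algorithm lam_pos L1_pos
    by unfold_locales (auto simp: field_simps)
  have p: "expectation (\<lambda>\<omega>. (norm (p k \<omega>))\<^sup>2) = expectation (\<lambda>\<omega>. (norm (residual k \<omega>))\<^sup>2)"
    if "k \<le> N" for k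
    by (intro Bochner_Integration.integral_cong refl) (simp only: p_eq[OF that])
  let ?rest = "(4 * (36 * \<rho> + 4 / L1) / \<kappa> + 4) * lam * \<sigma>\<^sup>2 + 8 * Dz * lam * \<sigma> / \<kappa>"
  have Dz0: "Dz \<ge> 0" using diam_nonneg lam_pos by (simp add: D_def zero_le_divide_iff)
  have "1 / (real N + 1) * (\<Sum>k=0..N. expectation (\<lambda>\<omega>. (norm (residual k \<omega>))\<^sup>2)) \<le> \<epsilon>\<^sup>2 + ?rest"
  proof (cases "Dz \<le> sqrt lam * h * \<epsilon>")
    case True
    then have Dh: "D / h \<le> \<epsilon>" using lam_pos h0 by (simp add: D_def field_simps)
    have "expectation (\<lambda>\<omega>. (norm (residual k \<omega>))\<^sup>2) \<le> \<epsilon>\<^sup>2" if "k \<le> N" for k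
      using integrable_residual[OF that] norm_residual_le[OF _ that] Dh
      by (intro integral_le_const AE_I2 power_mono) (auto intro: order.trans)
    then have "(\<Sum>k=0..N. expectation (\<lambda>\<omega>. (norm (residual k \<omega>))\<^sup>2)) \<le> (\<Sum>k=0..N. \<epsilon>\<^sup>2)"
      by (intro sum_mono) auto
    then have "1 / (real N + 1) * (\<Sum>k=0..N. expectation (\<lambda>\<omega>. (norm (residual k \<omega>))\<^sup>2)) \<le> \<epsilon>\<^sup>2"
      by (simp add: field_simps)
    moreover have "?rest \<ge> 0"
      using rho_pos L1_pos kappa0 lam_pos Dz0 sigma_nonneg by (intro add_nonneg_nonneg mult_nonneg_nonneg divide_nonneg_pos) auto
    ultimately show ?thesis by simp
  next
    case False
    have "bias = lam * L1 * \<mu> * sqrt (d / lam)"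
      unfolding bias_def by (simp add: d_eq)
    also have "\<dots> = (lam / sqrt lam) * (L1 * \<mu> * sqrt d)"
      by (simp add: real_sqrt_divide)
    also have "lam / sqrt lam = sqrt lam"
      using lam_pos by (simp add: real_div_sqrt)
    also have "sqrt lam * (L1 * \<mu> * sqrt d) \<le> sqrt lam * (L1 * \<mu> * ((d + 3) powr (3 / 2) / 2))"
      using lam_pos L1_pos mu_pos sqrt_le_three_halves_power[OF d1] by (intro mult_left_mono) auto
    finally have bias_le: "bias \<le> sqrt lam * T / 2" by (simp add: T_def)
    have d3: "((d + 3) powr (3 / 2))\<^sup>2 = (d + 3) ^ 3"
    proof -
      have "((d + 3) powr (3 / 2))\<^sup>2 = (d + 3) powr 3" using d1 by (simp add: powr_power)
      then show ?thesis using d1 by simp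
    qed
    have "a * \<mu>\<^sup>2 + b * \<mu> \<le> \<epsilon>\<^sup>2 / 4"
      using mu_le mu_pos Dz0 rho_pos lam_pos L1_pos kappa0 d1
      by (intro quadratic_root_bound) (simp_all add: a_eq b_eq flip: \<kappa>_def)
    moreover have "a * \<mu>\<^sup>2 = 4 * \<rho> * lam * T\<^sup>2 / \<kappa>" "b * \<mu> = 4 * lam * Dz * T / \<kappa>"
      by (simp_all add: a_eq b_eq T_def power_mult_distrib d3 flip: \<kappa>_def)
    ultimately have T_le: "4 * \<rho> * lam * T\<^sup>2 / \<kappa> + 4 * lam * Dz * T / \<kappa> \<le> \<epsilon>\<^sup>2 / 4" by simp
    \<comment> \<open>The \<open>- 1\<close> under the ceiling accounts for the average over
      \<open>N + 1\<close> iterates.\<close>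
    have "16 * lam\<^sup>2 * L1 * r0\<^sup>2 / \<kappa> * (1 / \<epsilon>\<^sup>2) - 1 \<le> real N"
      using N_ge unfolding ceiling_le_iff by (simp only: of_int_of_nat_eq \<kappa>_def)
    then have n: "16 * lam\<^sup>2 * L1 * r0\<^sup>2 / \<kappa> \<le> \<epsilon>\<^sup>2 * (real N + 1)"
      using eps_pos kappa0 by (simp add: field_simps)
    have "4 / c * (r0\<^sup>2 / (real N + 1)
        + (8 * h\<^sup>2 * V + 2 * h * (Dz / sqrt lam) * V1 + (2 * h * \<rho> / lam + c / 2) * V))
      \<le> \<epsilon>\<^sup>2 + (4 * (36 * \<rho> + 4 / L1) / \<kappa> + 4) * lam * \<sigma>\<^sup>2 + 8 * Dz * lam * \<sigma> / \<kappa>"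
      using False mu_pos L1_pos
      by (intro complexity_arithmetic[OF lam_pos L1_pos h0 rho_pos eps_pos sigma_nonneg _ _ \<kappa>_def kappa0
            h_le c_def V_def V1_def bias_nonneg bias_le _ T_le n]) (auto simp: T_def)
    with average_residual_le show ?thesis
      by (simp add: r0_eq D_def)
  qed
  then show ?thesis by (simp add: p \<kappa>_def)
qed

end
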